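(* Let $r$ be a positive integer, $q=e^{-t}$ with $t>0$, $z>0$, and let $\bm x=(x_1,\dots,x_r)$, $\bm y=(y_1,\dots,y_r)$ with nonzero complex entries. For any real $\alpha>r$, \[ L_\alpha(z\bm x;z^{-1}\bm y;q,z^\alpha)=\frac{\left(\frac{2\pi z^\alpha}{\alpha t}\right)^{1/2}e^{\frac{\alpha t}8+\frac{\alpha}{2t}(\log z)^2}}{\prod_{s=1}^r(zx_s;q)_\infty(qz^{-1}y_s;q)_\infty}\sum_{n\in\mathbb{Z}}H_\alpha\!\left(e^{2\pi in/\alpha}\bm x;e^{-2\pi in/\alpha}\bm y;q\right)e^{2\pi in\left(\frac12-\frac1t\log z\right)-\frac{2\pi^2n^2}{\alpha t}}. \]
   Context: For $a\in\mathbb{C}$, $(a;q)_\infty=\prod_{j\ge0}(1-aq^j)$ and for real $c$, $(a;q)_c:=(a;q)_\infty/(aq^c;q)_\infty$ (so $(a;q)_n$ is defined for all $n\in\mathbb{Z}$, and $1/(q;q)_{-n}=0$ for $n\ge1$). Real powers are $q^c=e^{-ct}$. For $c\in\mathbb{C}$ and a vector $\bm v$, $c\bm v$ is the componentwise product. For real $\alpha\ge r$, $w\in\mathbb{C}$ and vectors $\bm x,\bm y$ of nonzero complex numbers, \[ L_\alpha(\bm x;\bm y;q,w):=\sum_{n\in\mathbb{Z}}w^nq^{(\alpha-r)\binom n2}\prod_{s=1}^r\frac{(1/y_s;q)_n(-y_s)^n}{(x_s;q)_n}=\frac{1}{\prod_{s}(x_s;q)_\infty(qy_s;q)_\infty}\sum_{n\in\mathbb{Z}}w^nq^{\alpha\binom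 n2}\prod_s(x_sq^n;q)_\infty(y_sq^{1-n};q)_\infty, \] whenever it converges, and \[ H_\alpha(\bm x;\bm y;q):=\sum_{i_1,\dots,i_r,j_1,\dots,j_r\ge0}\frac{q^{\frac12Q_\alpha(\bm i,\bm j)}\prod_{s}(-x_s)^{i_s}(-y_s)^{j_s}}{\prod_s(q;q)_{i_s}(q;q)_{j_s}},\quad Q_\alpha(\bm i,\bm j)=\sum_{s}(i_s^2+j_s^2)-\frac1\alpha\Big(\sum_s(i_s-j_s)\Big)^2. \] *)

theory Defs
  imports "HOL-Analysis.Analysis"
begin

definition qpoch_inf :: "complex \<Rightarrow> real \<Rightarrow> complex" where
  "qpoch_inf a q = (\<Prod>j. 1 - a * of_real q ^ j)"

text \<open>
  The symbol \<open>(a;q)\<^sub>n\<close> for integer \<open>n\<close>. The quotient \<open>(a;q)\<^sub>\<infinity> / (a q^n;q)\<^sub>\<infinity>\<close> is literally \<open>0/0\<close>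
  when \<open>a\<close> and \<open>a q^n\<close> are both of the form \<open>q^(-m)\<close>, \<open>m \<ge> 0\<close>; its value there is the usual finite
  product. Lemma \<open>qpoch_eq_quotient\<close> below identifies both forms whenever the denominator does
  not vanish. At a pole (\<open>n < 0\<close>, \<open>a = q^j\<close> with \<open>1 \<le> j \<le> -n\<close>) the value is \<open>inverse 0 = 0\<close>, so
  that \<open>1/(a;q)\<^sub>n = 0\<close> there, in accordance with \<open>1/(q;q)\<^sub>-\<^sub>n = 0\<close> for \<open>n \<ge> 1\<close>.
\<close>
definition qpoch :: "complex \<Rightarrow> real \<Rightarrow> int \<Rightarrow> complex" where
  "qpoch a q n =
     (if n \<ge> 0 then (\<Prod>j<nat n. 1 - a * of_real q ^ j)
      else inverse (\<Prod>j=1..nat (-n). 1 - a / of_real q ^ j))"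

lemma convergent_prod_qpoch_inf:
  assumes "0 < q" "q < 1"
  shows "convergent_prod (\<lambda>j. 1 - a * complex_of_real q ^ j)"
proof -
  have "summable (\<lambda>j. norm a * q ^ j)"
    using assms by (intro summable_mult summable_geometric) auto
  hence "summable (\<lambda>j. norm ((1 - a * complex_of_real q ^ j) - 1))"
    using assms by (simp add: norm_mult norm_power)
  thus ?thesis
    by (intro abs_convergent_prod_imp_convergent_prod summable_imp_abs_convergent_prod)
qed

lemma qpoch_inf_split:
  assumes "0 < q" "q < 1"
  shows "qpoch_inf a q = (\<Prod>j<m. 1 - a * of_real q ^ j) * qpoch_inf (a * of_real q ^ m) q"
proof -
  let ?f = "\<lambda>j. 1 - a * complex_of_real q ^ j"
  let ?g = "\<lambda>j. 1 - (a * complex_of_real q ^ m) * complex_of_real q ^ j"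
  have f: "(\<lambda>n. \<Prod>j<n. ?f j) \<longlonglongrightarrow> qpoch_inf a q"
    using convergent_prod_LIMSEQ[OF convergent_prod_qpoch_inf[OF assms, of a]]
    unfolding qpoch_inf_def LIMSEQ_lessThan_iff_atMost .
  have g: "(\<lambda>n. \<Prod>j<n. ?g j) \<longlonglongrightarrow> qpoch_inf (a * of_real q ^ m) q"
    using convergent_prod_LIMSEQ[OF convergent_prod_qpoch_inf[OF assms, of "a * of_real q ^ m"]]
    unfolding qpoch_inf_def LIMSEQ_lessThan_iff_atMost .
  have split: "(\<Prod>j<n + m. ?f j) = (\<Prod>j<m. ?f j) * (\<Prod>j<n. ?g j)" for n
    by (induction n) (simp_all add: power_add mult_ac)
  have "(\<lambda>n. \<Prod>j<n + m. ?f j) \<longlonglongrightarrow> qpoch_inf a q"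
    using f by (rule LIMSEQ_ignore_initial_segment)
  moreover have "(\<lambda>n. \<Prod>j<n + m. ?f j)
      \<longlonglongrightarrow> (\<Prod>j<m. ?f j) * qpoch_inf (a * of_real q ^ m) q"
    unfolding split by (intro tendsto_mult_left g)
  ultimately show ?thesis
    by (rule LIMSEQ_unique)
qed

lemma qpoch_eq_quotient:
  assumes "0 < q" "q < 1" and nz: "qpoch_inf (a * of_real q powi n) q \<noteq> 0"
  shows "qpoch a q n = qpoch_inf a q / qpoch_inf (a * of_real q powi n) q"
proof (cases "n \<ge> 0")
  case True
  then show ?thesis
    using nz qpoch_inf_split[OF assms(1,2), of a "nat n"]
    by (simp add: qpoch_def power_int_def)
next
  case False
  define m where "m = nat (-n)"
  define b where "b = a * of_real q powi n"
  have b: "b = a / of_real q ^ m"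
    using False by (simp add: b_def m_def power_int_def field_simps)
  have "(\<Prod>j<m. 1 - b * of_real q ^ j) = (\<Prod>j=1..m. 1 - a / of_real q ^ j)"
  proof (rule prod.reindex_bij_witness[of _ "\<lambda>j. m - j" "\<lambda>j. m - j"])
    fix j assume "j \<in> {..<m}"
    then have "complex_of_real q ^ m = of_real q ^ (m - j) * of_real q ^ j"
      by (simp flip: power_add)
    then show "1 - a / complex_of_real q ^ (m - j) = 1 - b * complex_of_real q ^ j"
      using assms by (simp add: b)
  qed auto
  moreover have "b * of_real q ^ m = a"
    using assms by (simp add: b)
  ultimately have "qpoch_inf b q = (\<Prod>j=1..m. 1 - a / of_real q ^ j) * qpoch_inf a q"
    using qpoch_inf_split[OF assms(1,2), of b m] by simp
  then show ?thesis
    using False nz unfolding b_def[symmetric]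
    by (simp add: qpoch_def m_def[symmetric] field_simps)
qed

lemma inverse_qpoch_q_neg:
  assumes "0 < q" "n \<ge> 1"
  shows "1 / qpoch (of_real q) q (- int n) = 0"
proof -
  have "(\<Prod>j=1..n. 1 - complex_of_real q / of_real q ^ j) = 0"
    using assms by (intro prod_zero) (auto intro!: bexI[of _ 1])
  then show ?thesis
    using assms by (simp add: qpoch_def)
qed

text \<open>
  Here \<open>r = CARD('r)\<close>, and \<open>of_int n gchoose 2 = n (n - 1) / 2\<close> also for negative \<open>n\<close>.
\<close>
definition L_term ::
  "real \<Rightarrow> complex ^ 'r \<Rightarrow> complex ^ 'r \<Rightarrow> real \<Rightarrow> complex \<Rightarrow> int \<Rightarrow> complex" where
  "L_term \<alpha> x y q w n =
     w powi n * of_real (q powr ((\<alpha> - real CARD('r)) * (of_int n gchoose 2))) *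
     (\<Prod>s\<in>UNIV. qpoch (1 / y $ s) q n * (- (y $ s)) powi n / qpoch (x $ s) q n)"

definition L :: "real \<Rightarrow> complex ^ 'r \<Rightarrow> complex ^ 'r \<Rightarrow> real \<Rightarrow> complex \<Rightarrow> complex" where
  "L \<alpha> x y q w = (\<Sum>\<^sub>\<infinity>n. L_term \<alpha> x y q w n)"

definition Q :: "real \<Rightarrow> nat ^ 'r \<Rightarrow> nat ^ 'r \<Rightarrow> real" where
  "Q \<alpha> i j = (\<Sum>s\<in>UNIV. (real (i $ s))\<^sup>2 + (real (j $ s))\<^sup>2)
              - 1 / \<alpha> * (\<Sum>s\<in>UNIV. real (i $ s) - real (j $ s))\<^sup>2"

definition H_term ::
  "real \<Rightarrow> complex ^ 'r \<Rightarrow> complex ^ 'r \<Rightarrow> real \<Rightarrow> nat ^ 'r \<Rightarrow> nat ^ 'r \<Rightarrow> complex" where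
  "H_term \<alpha> x y q i j =
     of_real (q powr (1 / 2 * Q \<alpha> i j)) * (\<Prod>s\<in>UNIV. (- (x $ s)) ^ (i $ s) * (- (y $ s)) ^ (j $ s)) /
     (\<Prod>s\<in>UNIV. qpoch (of_real q) q (int (i $ s)) * qpoch (of_real q) q (int (j $ s)))"

definition H :: "real \<Rightarrow> complex ^ 'r \<Rightarrow> complex ^ 'r \<Rightarrow> real \<Rightarrow> complex" where
  "H \<alpha> x y q = (\<Sum>\<^sub>\<infinity>(i, j). H_term \<alpha> x y q i j)"

end

theory Submission
  imports Defs "HOL-Probability.Characteristic_Functions"
begin

text \<open>
  Expand every infinite product in the bilateral form of \<open>L\<close> by Euler's series
  \<open>(a;q)\<^sub>\<infinity> = (\<Sum>i. q^(i(i-1)/2) (-a)^i / (q;q)\<^sub>i)\<close>. For fixed \<open>(i, j)\<close> the sum over \<open>n\<close> is a Gaussian sum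
  whose centre depends only on \<open>d = \<Sum>s. i\<^sub>s - j\<^sub>s\<close>; completing the square in \<open>n\<close> produces the form
  \<open>Q\<^sub>\<alpha>\<close>. Poisson summation turns this Gaussian sum into a sum over \<open>m\<close> in which \<open>d\<close> only enters
  through the phase \<open>e^(2 \<pi> i m d / \<alpha>)\<close>, and this phase is absorbed by rotating \<open>x\<close> and \<open>y\<close> in \<open>H\<^sub>\<alpha>\<close>.
  Both interchanges of summation are absolutely convergent: \<open>Q\<^sub>\<alpha>\<close> is positive definite for
  \<open>\<alpha> > r\<close>, and Poisson summation itself bounds the Gaussian sums uniformly in their centre.
\<close>

section \<open>Poisson summation for Gaussians\<close>

text \<open>On the unit circle a real-linear function is
  \<open>A * cis \<theta> + B * cis (- \<theta>)\<close>, so multiplying by it only moves the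
  frequency \<open>k\<close> to \<open>k + 1\<close> and \<open>k - 1\<close>. Both \<open>h\<close>
  and \<open>k\<close> are generalized because a product of polynomials is handled by absorbing its
  first factor into \<open>h\<close>.\<close>

lemma real_polynomial_function_orthogonal:
  fixes p :: "complex \<Rightarrow> real" and h :: "real \<Rightarrow> complex"
  assumes "real_polynomial_function p"
    and "continuous_on {0..1} h"
    and "\<And>k::int. integral {0..1} (\<lambda>x. h x * cis (2 * pi * k * x)) = 0"
  shows "integral {0..1} (\<lambda>x. h x * of_real (p (cis (2 * pi * x))) * cis (2 * pi * of_int k * x)) = 0"
  using assms
proof (induction arbitrary: h k rule: real_polynomial_function.induct)
  case (linear f)
  \<comment> \<open>\<open>A\<close> and \<open>B\<close> come from writing cos and sin in
    \<open>cos \<theta> * f 1 + sin \<theta> * f \<i>\<close> through exponentials.\<close>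
  define A where "A = (of_real (f 1) - \<i> * of_real (f \<i>)) / 2"
  define B where "B = (of_real (f 1) + \<i> * of_real (f \<i>)) / 2"
  have f: "of_real (f (cis \<theta>)) = A * cis \<theta> + B * cis (- \<theta>)" for \<theta>
  proof -
    have "cis \<theta> = cos \<theta> *\<^sub>R 1 + sin \<theta> *\<^sub>R \<i>"
      by (simp add: complex_eq_iff)
    then have "f (cis \<theta>) = cos \<theta> * f 1 + sin \<theta> * f \<i>"
      using linear(1) by (simp only: bounded_linear.linear linear_add linear_scale) simp
    then show ?thesis
      by (simp add: A_def B_def complex_eq_iff field_simps)
  qed
  have "h x * of_real (f (cis (2 * pi * x))) * cis (2 * pi * of_int k * x)
      = A * (h x * cis (2 * pi * of_int (k + 1) * x)) + B * (h x * cis (2 * pi * of_int (k - 1) * x))" for x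
  proof -
    have "cis (2 * pi * of_int (k + 1) * x) = cis (2 * pi * of_int k * x) * cis (2 * pi * x)"
         "cis (2 * pi * of_int (k - 1) * x) = cis (2 * pi * of_int k * x) * cis (- (2 * pi * x))"
      by (simp_all add: cis_mult algebra_simps)
    then show ?thesis
      unfolding f by (simp only:) (simp add: algebra_simps)
  qed
  moreover have "(\<lambda>x. c * (h x * cis (2 * pi * of_int m * x))) integrable_on {0..1}" for c and m :: int
    by (intro integrable_continuous_real continuous_intros linear.prems)
  moreover have "integral {0..1} (\<lambda>x. h x * cis (2 * pi * of_int m * x)) = 0" for m :: int
    using linear.prems(2)[of m] by simp
  ultimately show ?case
    by (simp only: integral_add integral_mult_right) simp
next
  case (const c)
  have "h x * of_real c * cis (2 * pi * of_int k * x) = of_real c * (h x * cis (2 * pi * of_int k * x))" for x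
    by simp
  then show ?case
    using const(2)[of k] by (simp only: integral_mult_right) simp
next
  case (add f g)
  have cont: "continuous_on {0..1} (\<lambda>x. h x * of_real (u (cis (2 * pi * x))) * cis (2 * pi * of_int k * x))"
    if "real_polynomial_function u" for u
    using add.prems(1)
    by (intro continuous_intros continuous_on_compose2[OF continuous_on_polymonial_function[of u UNIV]])
       (use that in \<open>auto simp: real_polynomial_function_eq\<close>)
  show ?case
    using add.IH[OF add.prems, of k] cont[OF add.hyps(1)] cont[OF add.hyps(2)]
    by (simp add: algebra_simps integral_add integrable_continuous_real)
next
  case (mult f g)
  have cont: "continuous_on {0..1} (\<lambda>x. h x * of_real (f (cis (2 * pi * x))))"
    using mult.prems(1)
    by (intro continuous_intros continuous_on_compose2[OF continuous_on_polymonial_function[of f UNIV]])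
       (use mult.hyps in \<open>auto simp: real_polynomial_function_eq\<close>)
  \<comment> \<open>The hypothesis for \<open>g\<close> is applied to \<open>h * f\<close>, whose
    coefficients all vanish by the hypothesis for \<open>f\<close>.\<close>
  show ?case
    using mult.IH(2)[OF cont, of k] mult.IH(1)[OF mult.prems] by (simp add: mult_ac)
qed

text \<open>The delicate point is the cut of \<open>Arg2pi\<close> at 1. The constant homotopy from
  the loop \<open>h\<close> to itself induces a homotopy of circle maps, and its endpoints are
  continuous.\<close>

lemma continuous_loop_imp_continuous_on_circle:
  fixes h :: "real \<Rightarrow> 'a::real_normed_vector"
  assumes "continuous_on {0..1} h" "h 0 = h 1"
  shows "continuous_on (sphere 0 1) (\<lambda>z. h (Arg2pi z / (2 * pi)))"
proof -
  have "homotopic_loops UNIV h h"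
    using assms by (simp add: homotopic_loops_refl path_def pathfinish_def pathstart_def)
  from homotopic_loops_imp_homotopic_circlemaps[OF this] show ?thesis
    by (auto simp: o_def dest: homotopic_with_imp_continuous)
qed

text \<open>By Stone-Weierstrass the conjugate of \<open>h\<close>, carried over to the circle, is a
  uniform limit of polynomial functions. Since \<open>h\<close> integrates to 0 against each of
  them, the integral of the squared modulus of \<open>h\<close> is 0.\<close>

lemma fourier_coefficients_zero_imp_zero:
  fixes h :: "real \<Rightarrow> complex"
  assumes cont: "continuous_on {0..1} h" and loop: "h 0 = h 1"
    and coeff: "\<And>k::int. integral {0..1} (\<lambda>x. h x * cis (2 * pi * k * x)) = 0"
    and x: "x \<in> {0..1}"
  shows "h x = 0"
proof -
  define H where "H z = cnj (h (Arg2pi z / (2 * pi)))" for z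
  have contH: "continuous_on (sphere 0 1) H"
    unfolding H_def
    by (intro continuous_intros continuous_loop_imp_continuous_on_circle cont loop)
  have H_cis: "H (cis (2 * pi * x)) = cnj (h x)" if "x \<in> {0..1}" for x
  proof (cases "x = 1")
    \<comment> \<open>At the right endpoint \<open>Arg2pi\<close> returns 0 and not 2 pi, so the
      value is \<open>h 0\<close>, which equals \<open>h 1\<close>.\<close>
    case True
    then show ?thesis
      using loop Arg2pi_unique[of 1 0 1] by (simp add: H_def)
  next
    case False
    have "Arg2pi (cis (2 * pi * x)) = 2 * pi * x"
      using that False by (intro Arg2pi_unique[of 1]) (auto simp: cis_conv_exp)
    then show ?thesis
      by (simp add: H_def)
  qed
  have "compact (h ` {0..1})"
    using cont by (intro compact_continuous_image) auto
  then have "bounded (h ` {0..1})"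
    by (rule compact_imp_bounded)
  then obtain M where M: "\<And>x. x \<in> {0..1} \<Longrightarrow> norm (h x) \<le> M" and "M > 0"
    unfolding bounded_pos by blast
  have small: "norm (integral {0..1} (\<lambda>x. h x * cnj (h x))) \<le> e" if "e > 0" for e
  proof -
    \<comment> \<open>The tolerance \<open>e / M\<close> compensates the factor
      \<open>norm (h x) \<le> M\<close> in the integrand.\<close>
    have "e / M > 0" using that \<open>M > 0\<close> by simp
    from Stone_Weierstrass_polynomial_function[OF compact_sphere contH this] obtain g where
      g: "polynomial_function g" "\<And>z. z \<in> sphere 0 1 \<Longrightarrow> norm (H z - g z) < e / M"
      by blast
    have poly: "real_polynomial_function (Re \<circ> g)" "real_polynomial_function (Im \<circ> g)"
      using g(1) bounded_linear_Re bounded_linear_Im by (auto simp: polynomial_function_def)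
    have contg: "continuous_on {0..1} (\<lambda>x. g (cis (2 * pi * x)))"
      by (intro continuous_intros continuous_on_compose2[OF continuous_on_polymonial_function[of g UNIV]])
         (use g in auto)
    \<comment> \<open>Orthogonality is available for real-valued polynomials only, hence the split
      into real and imaginary part; the trivial factor of frequency 0 matches its form.\<close>
    have g_eq: "h x * g (cis (2 * pi * x)) =
        h x * of_real ((Re \<circ> g) (cis (2 * pi * x))) * cis (2 * pi * of_int 0 * x) +
        \<i> * (h x * of_real ((Im \<circ> g) (cis (2 * pi * x))) * cis (2 * pi * of_int 0 * x))" for x
      by (simp add: complex_eq_iff algebra_simps)
    have int: "(\<lambda>x. h x * of_real ((Re \<circ> g) (cis (2 * pi * x))) * cis (2 * pi * of_int 0 * x)) integrable_on {0..1}"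
      "(\<lambda>x. h x * of_real ((Im \<circ> g) (cis (2 * pi * x))) * cis (2 * pi * of_int 0 * x)) integrable_on {0..1}"
      using cont contg by (auto intro!: integrable_continuous_real continuous_intros simp: o_def)
    have orth: "integral {0..1} (\<lambda>x. h x * of_real (p (cis (2 * pi * x))) * cis (2 * pi * of_int 0 * x)) = 0"
      if "real_polynomial_function p" for p
      using that cont coeff by (rule real_polynomial_function_orthogonal)
    have zero: "integral {0..1} (\<lambda>x. h x * g (cis (2 * pi * x))) = 0"
      unfolding g_eq integral_add[OF int(1) integrable_on_mult_right[OF int(2)]]
      by (simp only: integral_mult_right orth[OF poly(1)] orth[OF poly(2)]) simp
    have "integral {0..1} (\<lambda>x. h x * cnj (h x)) =
          integral {0..1} (\<lambda>x. h x * cnj (h x) - h x * g (cis (2 * pi * x)))"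
      using cont contg zero
      by (subst integral_diff) (auto intro!: integrable_continuous_real continuous_intros)
    also have "\<dots> = integral {0..1} (\<lambda>x. h x * (cnj (h x) - g (cis (2 * pi * x))))"
      by (simp add: algebra_simps)
    also have "norm \<dots> \<le> e * (1 - 0)"
    proof (rule integral_bound)
      fix x :: real assume x: "x \<in> {0..1}"
      have "norm (h x) * norm (H (cis (2 * pi * x)) - g (cis (2 * pi * x))) \<le> M * (e / M)"
        using M[OF x] less_imp_le[OF g(2)[of "cis (2 * pi * x)"]] \<open>M > 0\<close> by (intro mult_mono) auto
      then show "norm (h x * (cnj (h x) - g (cis (2 * pi * x)))) \<le> e"
        using \<open>M > 0\<close> H_cis[OF x] by (simp add: norm_mult)
    qed (use cont contg in \<open>auto intro!: continuous_intros\<close>)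
    finally show ?thesis by simp
  qed
  have "norm (integral {0..1} (\<lambda>x. h x * cnj (h x))) \<le> 0"
    using small by (rule field_le_epsilon) auto
  moreover have "((\<lambda>x. complex_of_real ((norm (h x))\<^sup>2)) has_integral
      of_real (integral {0..1} (\<lambda>x. (norm (h x))\<^sup>2))) {0..1}"
    by (intro has_integral_of_real integrable_integral integrable_continuous_real continuous_intros cont)
  then have "integral {0..1} (\<lambda>x. h x * cnj (h x)) = of_real (integral {0..1} (\<lambda>x. (norm (h x))\<^sup>2))"
    by (simp add: complex_norm_square[symmetric] integral_unique)
  ultimately have "integral {0..1} (\<lambda>x. (norm (h x))\<^sup>2) = 0"
    by simp
  then have "\<forall>x\<in>{0..1}. (norm (h x))\<^sup>2 = 0"
    using cont by (subst (asm) integral_eq_0_iff) (auto intro!: continuous_intros)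
  then show ?thesis
    using x by simp
qed

section \<open>Termwise integration and Gaussian integrals\<close>

text \<open>The Weierstrass M-test gives uniform convergence along the net of finite subsets;
  continuity and integrals pass to such a limit.\<close>

lemma integral_infsum_uniform:
  fixes u :: "'b \<Rightarrow> real \<Rightarrow> complex"
  assumes cont: "\<And>n. continuous_on {a..b} (u n)"
    and bound: "\<And>n x. x \<in> {a..b} \<Longrightarrow> norm (u n x) \<le> M n"
    and M: "M summable_on UNIV"
  shows "continuous_on {a..b} (\<lambda>x. \<Sum>\<^sub>\<infinity>n. u n x)"
    and "((\<lambda>n. integral {a..b} (u n)) has_sum integral {a..b} (\<lambda>x. \<Sum>\<^sub>\<infinity>n. u n x)) UNIV"
proof -
  have lim: "uniform_limit {a..b} (\<lambda>X x. \<Sum>n\<in>X. u n x) (\<lambda>x. \<Sum>\<^sub>\<infinity>n. u n x) (finite_subsets_at_top UNIV)"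
    using bound M by (intro Weierstrass_m_test_general) auto
  show "continuous_on {a..b} (\<lambda>x. \<Sum>\<^sub>\<infinity>n. u n x)"
    by (rule uniform_limit_theorem[OF _ lim]) (auto intro!: always_eventually continuous_intros cont)
  obtain I J where IJ: "\<And>X. ((\<lambda>x. \<Sum>n\<in>X. u n x) has_integral I X) {a..b}"
     "((\<lambda>x. \<Sum>\<^sub>\<infinity>n. u n x) has_integral J) {a..b}" "(I \<longlongrightarrow> J) (finite_subsets_at_top UNIV)"
    by (rule uniform_limit_integral[OF lim]) (auto intro!: continuous_intros cont)
  have "I X = (\<Sum>n\<in>X. integral {a..b} (u n))" if "finite X" for X
  proof -
    have "((\<lambda>x. \<Sum>n\<in>X. u n x) has_integral (\<Sum>n\<in>X. integral {a..b} (u n))) {a..b}"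
      using that by (intro has_integral_sum integrable_integral integrable_continuous_real cont)
    with IJ(1) show ?thesis
      by (rule has_integral_unique)
  qed
  then have "eventually (\<lambda>X. I X = (\<Sum>n\<in>X. integral {a..b} (u n))) (finite_subsets_at_top UNIV)"
    by (simp add: eventually_finite_subsets_at_top_weakI)
  with IJ(3) have "((\<lambda>X. \<Sum>n\<in>X. integral {a..b} (u n)) \<longlongrightarrow> J) (finite_subsets_at_top UNIV)"
    by (rule Lim_transform_eventually)
  then show "((\<lambda>n. integral {a..b} (u n)) has_sum integral {a..b} (\<lambda>x. \<Sum>\<^sub>\<infinity>n. u n x)) UNIV"
    using IJ(2) by (simp add: has_sum_def integral_unique)
qed

text \<open>Scaling by \<open>sqrt (2 * a)\<close> turns the integrand into the standard normal
  density times a character, up to constants, so the value is read off from the characteristic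
  function of the normal distribution.\<close>

lemma gaussian_fourier_transform:
  fixes a \<xi> :: real
  assumes "a > 0"
  shows "integrable lborel (\<lambda>u. of_real (exp (- a * u\<^sup>2)) * cis (\<xi> * u))"
    and "(LBINT u. of_real (exp (- a * u\<^sup>2)) * cis (\<xi> * u)) = of_real (sqrt (pi / a) * exp (- \<xi>\<^sup>2 / (4 * a)))"
proof -
  let ?c = "sqrt (2 * a)"
  have c: "?c > 0" "?c * ?c = 2 * a"
    using assms by auto
  define f where "f u = complex_of_real (exp (- a * u\<^sup>2)) * cis (\<xi> * u)" for u
  have f_eq: "f (0 + (1 / ?c) * v) = sqrt (2 * pi) *\<^sub>R (std_normal_density v *\<^sub>R iexp (\<xi> / ?c * v))" for v
  proof -
    have "a * (v / ?c)\<^sup>2 = v\<^sup>2 / 2"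
      using assms c by (simp add: power_divide)
    then show ?thesis
      by (simp add: f_def std_normal_density_def cis_conv_exp scaleR_conv_of_real field_simps flip: of_real_mult)
  qed
  have int: "integrable lborel (\<lambda>v. std_normal_density v *\<^sub>R iexp (\<xi> / ?c * v))"
  proof (rule Bochner_Integration.integrable_bound)
    show "integrable lborel std_normal_density"
      by (rule integrable_normal_density) auto
  qed (auto simp: norm_exp_i_times)
  then have "integrable lborel (\<lambda>v. f (0 + (1 / ?c) * v))"
    unfolding f_eq by (rule integrable_scaleR_right)
  then show "integrable lborel (\<lambda>u. of_real (exp (- a * u\<^sup>2)) * cis (\<xi> * u))"
    using c(1) by (subst (asm) lborel_integrable_real_affine_iff) (auto simp: f_def[abs_def])
  have "char std_normal_distribution (\<xi> / ?c) = (LBINT v. std_normal_density v *\<^sub>R iexp (\<xi> / ?c * v))"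
    unfolding char_def by (subst integral_density) auto
  then have E: "(LBINT v. std_normal_density v *\<^sub>R iexp (\<xi> / ?c * v)) = of_real (exp (- \<xi>\<^sup>2 / (4 * a)))"
    using assms by (simp add: char_std_normal_distribution power_divide)
  have "(LBINT u. f u) = \<bar>1 / ?c\<bar> *\<^sub>R (LBINT v. f (0 + (1 / ?c) * v))"
    using c(1) by (intro lborel_integral_real_affine) auto
  also have "\<dots> = (\<bar>1 / ?c\<bar> * sqrt (2 * pi)) *\<^sub>R of_real (exp (- \<xi>\<^sup>2 / (4 * a)))"
    unfolding f_eq integral_scaleR_right E by simp
  also have "\<bar>1 / ?c\<bar> * sqrt (2 * pi) = sqrt (pi / a)"
    using assms by (simp add: real_sqrt_divide real_sqrt_mult)
  finally show "(LBINT u. of_real (exp (- a * u\<^sup>2)) * cis (\<xi> * u)) = of_real (sqrt (pi / a) * exp (- \<xi>\<^sup>2 / (4 * a)))"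
    by (simp add: f_def scaleR_conv_of_real)
qed

lemma summable_on_gaussian:
  fixes a :: real
  assumes "a > 0"
  shows "(\<lambda>n::int. exp (- a * (of_int n)\<^sup>2)) summable_on UNIV"
proof -
  have *: "(\<lambda>n::nat. exp (- a * (real n)\<^sup>2)) summable_on UNIV"
  proof (rule norm_summable_imp_summable_on, rule summable_comparison_test)
    show "summable (\<lambda>n. exp (- a) ^ n)"
      using assms by (intro summable_geometric) auto
    have "real n * a \<le> a * (real n)\<^sup>2" for n
      using assms by (cases n) (auto simp: power2_eq_square)
    then show "\<exists>N. \<forall>n\<ge>N. norm (norm (exp (- a * (real n)\<^sup>2))) \<le> exp (- a) ^ n"
      by (auto simp flip: exp_of_nat_mult)
  qed
  have "(\<lambda>n::int. exp (- a * (of_int n)\<^sup>2)) summable_on (range int \<union> range (\<lambda>n. - int n))"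
  proof (rule summable_on_union)
    show "(\<lambda>n::int. exp (- a * (of_int n)\<^sup>2)) summable_on (range int)"
      using * by (subst summable_on_reindex) (auto simp: o_def)
    show "(\<lambda>n::int. exp (- a * (of_int n)\<^sup>2)) summable_on (range (\<lambda>n. - int n))"
      using * by (subst summable_on_reindex) (auto simp: o_def inj_on_def)
  qed
  also have "range int \<union> range (\<lambda>n. - int n) = UNIV"
    by (auto intro: int_cases2)
  finally show ?thesis .
qed

text \<open>Half-open intervals tile the line disjointly, whereas the gauge integral is taken over
  the closed unit interval; they differ by one endpoint, a null set.\<close>

lemma integral_Ico_of_int:
  fixes F :: "real \<Rightarrow> complex"
  assumes "integrable lborel F" "continuous_on UNIV F"
  shows "(LBINT u:{of_int n..<of_int n + 1}. F u) = integral {0..1} (\<lambda>b. F (of_int n + b))"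
proof -
  have "(LBINT u:{of_int n..<of_int n + 1}. F u) = (LBINT b:{0..<1}. F (of_int n + b))"
    unfolding set_lebesgue_integral_def
    by (subst lborel_integral_real_affine[where c = 1 and t = "of_int n"])
       (auto intro!: Bochner_Integration.integral_cong split: split_indicator)
  also have "\<dots> = (LBINT b:{0..1}. F (of_int n + b))"
    unfolding set_lebesgue_integral_def
  proof (rule integral_cong_AE)
    show "AE x in lborel. indicator {0..<1} x *\<^sub>R F (of_int n + x) = indicator {0..1} x *\<^sub>R F (of_int n + x)"
      using AE_lborel_singleton[of "1::real"] by eventually_elim (auto split: split_indicator)
  qed (use assms in \<open>auto intro!: borel_measurable_continuous_onI continuous_intros
                        continuous_on_compose2[OF assms(2)]\<close>)
  also have "\<dots> = integral {0..1} (\<lambda>b. F (of_int n + b))"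
    by (intro set_borel_integral_eq_integral borel_integrable_atLeastAtMost'
          continuous_on_compose2[OF assms(2)] continuous_intros) auto
  finally show ?thesis .
qed

text \<open>Countable additivity of the Lebesgue integral, with the unit intervals enumerated by
  \<open>int_decode\<close>.\<close>

lemma integral_UNIV_eq_sum_unit_intervals:
  fixes F :: "real \<Rightarrow> complex"
  assumes "integrable lborel F" "continuous_on UNIV F"
    and "((\<lambda>n::int. integral {0..1} (\<lambda>b. F (of_int n + b))) has_sum S) UNIV"
  shows "(LBINT u. F u) = S"
proof -
  define A where "A i = {real_of_int (int_decode i)..<of_int (int_decode i) + 1}" for i
  have "\<exists>i. x \<in> A i" for x
    by (rule exI[of _ "int_encode \<lfloor>x\<rfloor>"]) (simp add: A_def)
  then have U: "(\<Union>i. A i) = UNIV"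
    by auto
  have disj: "A i \<inter> A j = {}" if "i \<noteq> j" for i j
  proof -
    have "x \<in> A i \<longleftrightarrow> \<lfloor>x\<rfloor> = int_decode i" for x i
      by (simp add: A_def floor_eq_iff)
    then show ?thesis
      using that by (auto simp: int_decode_eq)
  qed
  have "((\<lambda>i. integral {0..1} (\<lambda>b. F (of_int (int_decode i) + b))) has_sum S) UNIV"
    using assms(3) by (subst has_sum_reindex_bij_betw[OF bij_int_decode])
  then have "S = (\<Sum>i. integral {0..1} (\<lambda>b. F (of_int (int_decode i) + b)))"
    by (intro sums_unique has_sum_imp_sums)
  also have "\<dots> = (\<Sum>i. LBINT u:A i. F u)"
    unfolding A_def by (simp only: integral_Ico_of_int[OF assms(1,2)])
  also have "\<dots> = (LBINT u:(\<Union>i. A i). F u)"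
  proof (rule lebesgue_integral_countable_add[symmetric, OF _ disj])
    show "set_integrable lborel (\<Union>i. A i) F"
      using assms(1) by (simp add: U set_integrable_def)
  qed (auto simp: A_def)
  finally show ?thesis
    by (simp add: U set_lebesgue_integral_def)
qed

text \<open>The exponents differ by \<open>a / 2 * (n + 2 * b)^2\<close>. For \<open>b\<close> in a
  bounded set this gives a summable majorant independent of \<open>b\<close>.\<close>

lemma gaussian_translate_le:
  fixes a b :: real
  assumes "a > 0"
  shows "exp (- a * (of_int n + b)\<^sup>2) \<le> exp (a * b\<^sup>2) * exp (- (a / 2) * (of_int n)\<^sup>2)"
proof -
  have "0 \<le> a * (of_int n + 2 * b)\<^sup>2"
    using assms by simp
  then show ?thesis
    by (simp add: power2_eq_square algebra_simps flip: exp_add)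
qed

lemma summable_on_gaussian_translate:
  fixes a b :: real
  assumes "a > 0"
  shows "(\<lambda>n::int. exp (- a * (of_int n + b)\<^sup>2)) summable_on UNIV"
proof (rule summable_on_comparison_test)
  show "(\<lambda>n::int. exp (a * b\<^sup>2) * exp (- (a / 2) * (of_int n)\<^sup>2)) summable_on UNIV"
    using assms by (intro summable_on_cmult_right summable_on_gaussian) auto
qed (use gaussian_translate_le[OF assms] in auto)

lemma integral_cis_int:
  "integral {0..1} (\<lambda>x. cis (2 * pi * of_int n * x)) = (if n = 0 then 1 else 0)"
proof (cases "n = 0")
  case False
  define c where "c = 2 * pi * \<i> * of_int n"
  have c: "c \<noteq> 0"
    using False by (simp add: c_def)
  have "((\<lambda>x. exp (c * of_real x)) has_integral (exp (c * of_real 1) / c - exp (c * of_real 0) / c)) {0..1}"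
    by (rule fundamental_theorem_of_calculus)
       (auto intro!: derivative_eq_intros has_vector_derivative_real_field simp: c)
  moreover have "exp c = 1"
    unfolding c_def using exp_integer_2pi[of "of_int n"] by (simp add: mult_ac)
  moreover have "cis (2 * pi * of_int n * x) = exp (c * of_real x)" for x
    by (simp add: c_def cis_conv_exp mult_ac)
  ultimately show ?thesis
    using False by (simp add: has_integral_iff)
qed simp

text \<open>
  Both sides are continuous and have period 1 in \<open>b\<close>; their Fourier coefficients agree because
  those of the left-hand side unfold to the Fourier transform of the Gaussian.
\<close>
theorem gaussian_poisson_summation:
  fixes a b :: real
  assumes a: "a > 0"
  shows "(\<Sum>\<^sub>\<infinity>n::int. complex_of_real (exp (- a * (of_int n + b)\<^sup>2))) =
    of_real (sqrt (pi / a)) * (\<Sum>\<^sub>\<infinity>m::int. of_real (exp (- pi\<^sup>2 * (of_int m)\<^sup>2 / a)) * cis (2 * pi * of_int m * b))"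
proof -
  define f where "f b = (\<Sum>\<^sub>\<infinity>n::int. complex_of_real (exp (- a * (of_int n + b)\<^sup>2)))" for b
  define C where "C m = exp (- pi\<^sup>2 * (of_int m)\<^sup>2 / a)" for m :: int
  define g where "g b = (\<Sum>\<^sub>\<infinity>m::int. of_real (C m) * cis (2 * pi * of_int m * b))" for b
  define h where "h b = f b - of_real (sqrt (pi / a)) * g b" for b
  have C: "C summable_on UNIV"
    unfolding C_def using summable_on_gaussian[of "pi\<^sup>2 / a"] a by (simp add: mult_ac)
  have f_periodic: "f (b + of_int k) = f b" for b and k :: int
    unfolding f_def
    by (rule infsum_reindex_bij_witness[of UNIV "\<lambda>n. n - k" "\<lambda>n. n + k"]) (auto simp: algebra_simps)
  have g_periodic: "g (b + of_int k) = g b" for b and k :: int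
  proof -
    have "cis (2 * pi * of_int m * (b + of_int k)) = cis (2 * pi * of_int m * b)" for m :: int
      using cis_multiple_2pi[of "of_int (m * k)"]
      by (simp add: distrib_left mult_ac flip: cis_mult)
    then show ?thesis
      by (simp only: g_def)
  qed
  \<comment> \<open>The free phase \<open>\<theta>\<close> lets one majorant serve both
    \<open>f\<close> itself and the integrands of its Fourier coefficients.\<close>
  have f_bound: "norm (complex_of_real (exp (- a * (of_int n + b)\<^sup>2)) * cis \<theta>)
      \<le> exp a * exp (- (a / 2) * (of_int n)\<^sup>2)" if "b \<in> {0..1}" for b \<theta> and n :: int
  proof -
    have "a * b\<^sup>2 \<le> a"
      using that a by (simp add: power_le_one)
    then have "exp (a * b\<^sup>2) * exp (- (a / 2) * (of_int n)\<^sup>2) \<le> exp a * exp (- (a / 2) * (of_int n)\<^sup>2)"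
      by simp
    with gaussian_translate_le[OF a, of n b]
    have "exp (- a * (of_int n + b)\<^sup>2) \<le> exp a * exp (- (a / 2) * (of_int n)\<^sup>2)"
      by (rule order.trans)
    then show ?thesis
      by (simp add: norm_mult)
  qed
  have f_bound_summable: "(\<lambda>n::int. exp a * exp (- (a / 2) * (of_int n)\<^sup>2)) summable_on UNIV"
    using a by (intro summable_on_cmult_right summable_on_gaussian) auto
  have f_cont: "continuous_on {0..1} f"
  proof -
    have "continuous_on {0..1} (\<lambda>b. \<Sum>\<^sub>\<infinity>n::int. complex_of_real (exp (- a * (of_int n + b)\<^sup>2)) * cis 0)"
      by (rule integral_infsum_uniform(1)[OF _ f_bound f_bound_summable]) (auto intro!: continuous_intros)
    then show ?thesis
      by (simp add: f_def[abs_def])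
  qed
  have g_cont: "continuous_on {0..1} g"
    unfolding g_def
    by (rule integral_infsum_uniform(1)[OF _ _ C]) (auto intro!: continuous_intros simp: norm_mult C_def)
  have f_coeff: "integral {0..1} (\<lambda>x. f x * cis (2 * pi * of_int k * x)) = of_real (sqrt (pi / a) * C k)" for k :: int
  proof -
    \<comment> \<open>The phase is unchanged under integer shifts, so all terms of the coefficient
      are integrals of the single function \<open>F\<close> over unit intervals; together they form
      its integral over the line.\<close>
    define F where "F u = complex_of_real (exp (- a * u\<^sup>2)) * cis ((2 * pi * of_int k) * u)" for u
    have F_shift: "F (of_int n + x) = of_real (exp (- a * (of_int n + x)\<^sup>2)) * cis (2 * pi * of_int k * x)" for n :: int and x
    proof -
      have "cis (2 * pi * of_int k * (of_int n + x)) = cis (2 * pi * of_int k * x)"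
        using cis_multiple_2pi[of "of_int (k * n)"]
        by (simp add: distrib_left mult_ac flip: cis_mult)
      then show ?thesis
        by (simp add: F_def)
    qed
    have "((\<lambda>n::int. integral {0..1} (\<lambda>x. F (of_int n + x))) has_sum
           integral {0..1} (\<lambda>x. \<Sum>\<^sub>\<infinity>n::int. F (of_int n + x))) UNIV"
      unfolding F_shift
      by (rule integral_infsum_uniform(2)[OF _ f_bound f_bound_summable]) (auto intro!: continuous_intros)
    moreover have "continuous_on UNIV F"
      unfolding F_def by (intro continuous_intros)
    moreover have "integrable lborel F"
      using gaussian_fourier_transform(1)[OF a] unfolding F_def .
    ultimately have "integral {0..1} (\<lambda>x. \<Sum>\<^sub>\<infinity>n::int. F (of_int n + x)) = (LBINT u. F u)"
      by (intro integral_UNIV_eq_sum_unit_intervals[symmetric])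
    also have "\<dots> = of_real (sqrt (pi / a) * C k)"
      unfolding F_def gaussian_fourier_transform(2)[OF a] by (simp add: C_def power_mult_distrib)
    also have "(\<lambda>x. \<Sum>\<^sub>\<infinity>n::int. F (of_int n + x)) = (\<lambda>x. f x * cis (2 * pi * of_int k * x))"
      unfolding F_shift f_def by (simp add: infsum_cmult_left')
    finally show ?thesis .
  qed
  have g_coeff: "integral {0..1} (\<lambda>x. g x * cis (2 * pi * of_int k * x)) = of_real (C k)" for k :: int
  proof -
    have eq: "of_real (C m) * cis (2 * pi * of_int m * x) * cis (2 * pi * of_int k * x) =
        of_real (C m) * cis (2 * pi * of_int (m + k) * x)" for m x
      by (simp add: cis_mult algebra_simps)
    have "((\<lambda>m::int. integral {0..1} (\<lambda>x. of_real (C m) * cis (2 * pi * of_int (m + k) * x))) has_sum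
           integral {0..1} (\<lambda>x. \<Sum>\<^sub>\<infinity>m::int. of_real (C m) * cis (2 * pi * of_int (m + k) * x))) UNIV"
      by (rule integral_infsum_uniform(2)[OF _ _ C]) (auto intro!: continuous_intros simp: norm_mult C_def)
    \<comment> \<open>Only \<open>m = - k\<close> survives the integration; the result is
      \<open>C k\<close> because \<open>C\<close> is even.\<close>
    moreover have "integral {0..1} (\<lambda>x. of_real (C m) * cis (2 * pi * of_int (m + k) * x)) =
        (if m = - k then of_real (C k) else 0)" for m
      unfolding integral_mult_right integral_cis_int by (auto simp: C_def)
    moreover have "((\<lambda>m. if m = - k then complex_of_real (C k) else 0) has_sum of_real (C k)) UNIV"
      by (rule has_sum_finite_neutralI[of "{- k}"]) auto
    ultimately have "integral {0..1} (\<lambda>x. \<Sum>\<^sub>\<infinity>m::int. of_real (C m) * cis (2 * pi * of_int (m + k) * x)) = of_real (C k)"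
      by (simp only: has_sum_unique)
    then show ?thesis
      unfolding g_def by (simp only: infsum_cmult_left'[symmetric] eq)
  qed
  have h_zero: "h x = 0" if "x \<in> {0..1}" for x
  proof (rule fourier_coefficients_zero_imp_zero[OF _ _ _ that])
    show "continuous_on {0..1} h"
      unfolding h_def by (intro continuous_intros f_cont g_cont)
    show "h 0 = h 1"
      using f_periodic[of 0 1] g_periodic[of 0 1] by (simp add: h_def)
    fix k :: int
    have "h x * cis (2 * pi * of_int k * x) = f x * cis (2 * pi * of_int k * x) -
        of_real (sqrt (pi / a)) * (g x * cis (2 * pi * of_int k * x))" for x
      by (simp add: h_def algebra_simps)
    moreover have "(\<lambda>x. f x * cis (2 * pi * of_int k * x)) integrable_on {0..1}"
      "(\<lambda>x. of_real (sqrt (pi / a)) * (g x * cis (2 * pi * of_int k * x))) integrable_on {0..1}"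
      by (intro integrable_continuous_real continuous_intros f_cont g_cont)+
    ultimately show "integral {0..1} (\<lambda>x. h x * cis (2 * pi * of_int k * x)) = 0"
      by (simp only: integral_diff integral_mult_right f_coeff g_coeff) simp
  qed
  \<comment> \<open>Periodicity carries the vanishing from the unit interval to every real
    \<open>b\<close>.\<close>
  have "h (frac b) = 0"
    by (rule h_zero) (simp add: frac_lt_1 less_imp_le)
  then have "h b = 0"
    using f_periodic[of "frac b" "\<lfloor>b\<rfloor>"] g_periodic[of "frac b" "\<lfloor>b\<rfloor>"] by (simp add: h_def frac_def)
  then show ?thesis
    by (simp add: h_def f_def g_def C_def)
qed

text \<open>After Poisson summation the centre \<open>b\<close> enters only through phases of
  modulus 1, so taking norms removes it. The resulting uniformity in \<open>b\<close> is what makes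
  the double sum over Euler indices and \<open>n\<close> converge absolutely.\<close>

lemma infsum_gaussian_translate_le:
  fixes a b :: real
  assumes a: "a > 0"
  shows "(\<Sum>\<^sub>\<infinity>n::int. exp (- a * (of_int n + b)\<^sup>2)) \<le>
    sqrt (pi / a) * (\<Sum>\<^sub>\<infinity>m::int. exp (- pi\<^sup>2 * (of_int m)\<^sup>2 / a))"
proof -
  have C: "(\<lambda>m::int. exp (- pi\<^sup>2 * (of_int m)\<^sup>2 / a)) summable_on UNIV"
    using summable_on_gaussian[of "pi\<^sup>2 / a"] a by (simp add: mult_ac)
  have "(\<Sum>\<^sub>\<infinity>n::int. exp (- a * (of_int n + b)\<^sup>2)) =
        norm (complex_of_real (\<Sum>\<^sub>\<infinity>n::int. exp (- a * (of_int n + b)\<^sup>2)))"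
    by (simp add: infsum_nonneg)
  also have "complex_of_real (\<Sum>\<^sub>\<infinity>n::int. exp (- a * (of_int n + b)\<^sup>2)) =
        (\<Sum>\<^sub>\<infinity>n::int. complex_of_real (exp (- a * (of_int n + b)\<^sup>2)))"
    by (rule infsumI[symmetric]) (intro has_sum_of_real has_sum_infsum summable_on_gaussian_translate a)
  also have "\<dots> = of_real (sqrt (pi / a)) *
      (\<Sum>\<^sub>\<infinity>m::int. of_real (exp (- pi\<^sup>2 * (of_int m)\<^sup>2 / a)) * cis (2 * pi * of_int m * b))"
    by (rule gaussian_poisson_summation[OF a])
  also have "norm \<dots> \<le> sqrt (pi / a) * (\<Sum>\<^sub>\<infinity>m::int. exp (- pi\<^sup>2 * (of_int m)\<^sup>2 / a))"
  proof -
    have "norm (\<Sum>\<^sub>\<infinity>m::int. of_real (exp (- pi\<^sup>2 * (of_int m)\<^sup>2 / a)) * cis (2 * pi * of_int m * b)) \<le>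
        (\<Sum>\<^sub>\<infinity>m::int. norm (of_real (exp (- pi\<^sup>2 * (of_int m)\<^sup>2 / a)) * cis (2 * pi * of_int m * b)))"
      using C by (intro norm_infsum_bound) (simp add: norm_mult)
    also have "\<dots> = (\<Sum>\<^sub>\<infinity>m::int. exp (- pi\<^sup>2 * (of_int m)\<^sup>2 / a))"
      by (simp add: norm_mult)
    finally show ?thesis
      using a by (simp add: norm_mult mult_left_mono)
  qed
  finally show ?thesis .
qed

section \<open>Euler's series\<close>

lemma qpoch_q_ne_0:
  assumes "0 < q" "q < 1"
  shows "qpoch (of_real q) q (int i) \<noteq> 0"
proof -
  have "q * q ^ j < 1" for j
    using assms power_Suc_less_one[of q j] by simp
  then have "1 - complex_of_real q * of_real q ^ j \<noteq> 0" for j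
    by (metis eq_iff_diff_eq_0 less_irrefl of_real_1 of_real_eq_iff of_real_mult of_real_power)
  then show ?thesis
    by (simp add: qpoch_def)
qed

text \<open>Every factor is at least \<open>1 - q\<close> in norm. The bound is crude but only
  geometric in \<open>i\<close>, hence harmless beside a Gaussian factor.\<close>

lemma norm_qpoch_q_ge:
  assumes "0 < q" "q < 1"
  shows "norm (qpoch (of_real q) q (int i)) \<ge> (1 - q) ^ i"
proof -
  have "(\<Prod>j<i. 1 - q) \<le> (\<Prod>j<i. norm (1 - complex_of_real q * of_real q ^ j))"
  proof (rule prod_mono, intro conjI)
    fix j
    have "q * q ^ j \<le> q"
      using assms by (simp add: power_le_one)
    then have "1 - q \<le> 1 - norm (complex_of_real q * of_real q ^ j)"
      using assms by (simp add: norm_mult norm_power)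
    also have "\<dots> \<le> norm (1 - complex_of_real q * of_real q ^ j)"
      using norm_triangle_ineq2[of 1 "complex_of_real q * of_real q ^ j"] by simp
    finally show "1 - q \<le> norm (1 - complex_of_real q * of_real q ^ j)" .
  qed (use assms in auto)
  then show ?thesis
    by (simp add: qpoch_def prod_norm)
qed

text \<open>Root test: the term is the \<open>i\<close>-th power of
  \<open>(q powr \<delta>) ^ i * v\<close>, which tends to 0.\<close>

lemma summable_gaussian_powser:
  fixes q \<delta> v :: real
  assumes "0 < q" "q < 1" "\<delta> > 0" "v \<ge> 0"
  shows "summable (\<lambda>i::nat. q powr (\<delta> * (real i)\<^sup>2) * v ^ i)"
proof -
  have "(\<lambda>i::nat. (q powr \<delta>) ^ i * v) \<longlonglongrightarrow> 0 * v"
    using assms powr_less_mono2[of \<delta> q 1] by (intro tendsto_intros LIMSEQ_power_zero) auto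
  then have "eventually (\<lambda>i. (q powr \<delta>) ^ i * v < 1 / 2) sequentially"
    by (rule order_tendstoD) auto
  then have "eventually (\<lambda>i. norm (q powr (\<delta> * (real i)\<^sup>2) * v ^ i) \<le> (1 / 2) ^ i) sequentially"
  proof eventually_elim
    case (elim i)
    have "q powr (\<delta> * (real i)\<^sup>2) * v ^ i = ((q powr \<delta>) ^ i * v) ^ i"
      using assms by (simp add: power_mult_distrib power2_eq_square powr_powr[symmetric] powr_realpow
          flip: power_mult mult.assoc)
    also have "\<dots> \<le> (1 / 2) ^ i"
      using elim assms by (intro power_mono) auto
    finally show ?case
      using assms by simp
  qed
  then show ?thesis
    by (rule summable_comparison_test_ev) (simp add: summable_geometric)
qed

text \<open>Serves the Euler series with \<open>\<delta> = 1 / 2\<close> and the series of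
  \<open>H\<close> with the \<open>\<delta>\<close> supplied by positive definiteness of
  \<open>Q\<close>.\<close>

lemma summable_norm_q_exponential:
  fixes q \<delta> :: real and w :: complex
  assumes "0 < q" "q < 1" "\<delta> > 0"
  shows "summable (\<lambda>i::nat. norm (of_real (q powr (\<delta> * (real i)\<^sup>2)) * w ^ i / qpoch (of_real q) q (int i)))"
proof (rule summable_comparison_test)
  show "summable (\<lambda>i::nat. q powr (\<delta> * (real i)\<^sup>2) * (norm w / (1 - q)) ^ i)"
    using assms by (intro summable_gaussian_powser) auto
  show "\<exists>N. \<forall>i\<ge>N. norm (norm (of_real (q powr (\<delta> * (real i)\<^sup>2)) * w ^ i / qpoch (of_real q) q (int i)))
      \<le> q powr (\<delta> * (real i)\<^sup>2) * (norm w / (1 - q)) ^ i"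
  proof (intro exI[of _ 0] allI impI)
    fix i :: nat
    have "norm w ^ i / norm (qpoch (of_real q) q (int i)) \<le> norm w ^ i / (1 - q) ^ i"
      using assms by (intro divide_left_mono norm_qpoch_q_ge mult_pos_pos) (auto simp: qpoch_q_ne_0)
    then have "q powr (\<delta> * (real i)\<^sup>2) * (norm w ^ i / norm (qpoch (of_real q) q (int i)))
        \<le> q powr (\<delta> * (real i)\<^sup>2) * (norm w ^ i / (1 - q) ^ i)"
      by (rule mult_left_mono) simp
    then show "norm (norm (of_real (q powr (\<delta> * (real i)\<^sup>2)) * w ^ i / qpoch (of_real q) q (int i)))
        \<le> q powr (\<delta> * (real i)\<^sup>2) * (norm w / (1 - q)) ^ i"
      by (simp add: norm_mult norm_divide norm_power power_divide)
  qed
qed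

section \<open>Euler's expansion of the infinite product\<close>

text \<open>The exponent is a real \<open>powr\<close>, not a natural binomial, so that it can be
  split and later merged into a completed square.\<close>

definition euler_term :: "real \<Rightarrow> complex \<Rightarrow> nat \<Rightarrow> complex" where
  "euler_term q a i = of_real (q powr (real i * (real i - 1) / 2)) * (- a) ^ i / qpoch (of_real q) q (int i)"

lemma summable_norm_euler_term:
  assumes "0 < q" "q < 1"
  shows "summable (\<lambda>i. norm (euler_term q a i))"
proof -
  \<comment> \<open>The linear part of \<open>i * (i - 1) / 2\<close> is absorbed into the base of
    the power.\<close>
  have "euler_term q a i = of_real (q powr (1 / 2 * (real i)\<^sup>2)) * (of_real (q powr (- 1 / 2)) * (- a)) ^ i
      / qpoch (of_real q) q (int i)" for i
  proof -
    have "q powr (real i * (real i - 1) / 2) = q powr (1 / 2 * (real i)\<^sup>2) * (q powr (- 1 / 2)) powr real i"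
      unfolding powr_powr powr_add[symmetric] by (simp add: power2_eq_square field_simps)
    then show ?thesis
      unfolding euler_term_def power_mult_distrib using assms by (simp add: powr_realpow)
  qed
  then show ?thesis
    by (simp only:) (rule summable_norm_q_exponential[OF assms], simp)
qed

text \<open>The factor \<open>1 - q ^ Suc i\<close> cancels the last factor of the denominator, and
  the binomial exponent grows by \<open>i\<close>, which rescales \<open>a\<close> to
  \<open>a * q\<close>.\<close>

lemma euler_term_Suc:
  assumes "0 < q" "q < 1"
  shows "euler_term q a (Suc i) * (1 - of_real q ^ Suc i) = - a * euler_term q (a * of_real q) i"
proof -
  have ne: "1 - complex_of_real q * of_real q ^ i \<noteq> 0"
    using qpoch_q_ne_0[OF assms, of "Suc i"] by (simp add: qpoch_def nat_add_distrib)
  have "qpoch (of_real q) q (int (Suc i)) = qpoch (of_real q) q (int i) * (1 - of_real q ^ Suc i)"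
    by (simp add: qpoch_def nat_add_distrib)
  moreover have "q powr (real (Suc i) * (real (Suc i) - 1) / 2) = q powr (real i * (real i - 1) / 2) * q ^ i"
    using assms unfolding powr_realpow[OF assms(1), symmetric] powr_add[symmetric] by (simp add: field_simps)
  ultimately show ?thesis
    using ne qpoch_q_ne_0[OF assms, of i]
    by (simp add: euler_term_def power_minus[of "a * of_real q"] power_minus[of a] power_mult_distrib)
qed

text \<open>
  The functional equation \<open>F(a) = (1 - a) F(a q)\<close> together with continuity at 0 identifies the
  series with the product.
\<close>
lemma euler_term_sums:
  assumes "0 < q" "q < 1"
  shows "euler_term q a sums qpoch_inf a q"
proof -
  define F where "F a = (\<Sum>i. euler_term q a i)" for a
  have summable: "summable (euler_term q a)" for a
    using summable_norm_euler_term[OF assms] by (rule summable_norm_cancel)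
  have F_eq: "F a = (1 - a) * F (a * of_real q)" for a
  proof -
    have q_shift: "euler_term q (a * of_real q) i = euler_term q a i * of_real q ^ i" for i
      by (simp add: euler_term_def power_mult_distrib power_minus[of "a * of_real q"] power_minus[of a])
    \<comment> \<open>The factor \<open>1 - q ^ i\<close> kills the term \<open>i = 0\<close>, so
      the index can be shifted and \<open>euler_term_Suc\<close> applies.\<close>
    have "F a - F (a * of_real q) = (\<Sum>i. euler_term q a i * (1 - of_real q ^ i))"
      unfolding F_def by (subst suminf_diff[OF summable summable]) (simp add: q_shift algebra_simps)
    also have "\<dots> = (\<Sum>i. euler_term q a (Suc i) * (1 - of_real q ^ Suc i))"
    proof (subst suminf_split_head)
      show "summable (\<lambda>i. euler_term q a i * (1 - of_real q ^ i))"
        using summable_diff[OF summable summable, of a "a * of_real q"] by (simp add: q_shift algebra_simps)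
    qed simp
    also have "\<dots> = - a * F (a * of_real q)"
      unfolding euler_term_Suc[OF assms] F_def by (rule suminf_mult[OF summable])
    finally show ?thesis
      by (simp add: algebra_simps)
  qed
  have F_iter: "F a = (\<Prod>j<N. 1 - a * of_real q ^ j) * F (a * of_real q ^ N)" for N
    by (induction N) (simp_all add: F_eq[of "a * of_real q ^ _"] mult_ac)
  \<comment> \<open>As a function of \<open>a\<close>, \<open>F\<close> is a power series converging
    everywhere.\<close>
  have "isCont F 0"
  proof -
    define c where "c i = euler_term q 1 i" for i
    have c: "euler_term q a i = c i * a ^ i" for a i
      by (simp add: c_def euler_term_def power_minus[of a])
    show ?thesis
      unfolding F_def c using summable[unfolded c] by (rule isCont_powser_converges_everywhere)
  qed
  moreover have "(\<lambda>N. a * of_real q ^ N) \<longlonglongrightarrow> a * 0"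
    using assms by (intro tendsto_intros LIMSEQ_power_zero) auto
  ultimately have "(\<lambda>N. F (a * of_real q ^ N)) \<longlonglongrightarrow> F 0"
    by (auto intro: isCont_tendsto_compose)
  moreover have "F 0 = 1"
  proof -
    have "euler_term q 0 = (\<lambda>i. if i = 0 then 1 else 0)"
      using assms by (auto simp: euler_term_def qpoch_def)
    then have "euler_term q 0 sums 1"
      using sums_single[of 0 "\<lambda>_. 1 :: complex"] by simp
    then show ?thesis
      unfolding F_def by (simp add: sums_iff)
  qed
  moreover have "(\<lambda>N. \<Prod>j<N. 1 - a * of_real q ^ j) \<longlonglongrightarrow> qpoch_inf a q"
    using convergent_prod_LIMSEQ[OF convergent_prod_qpoch_inf[OF assms, of a]]
    unfolding qpoch_inf_def LIMSEQ_lessThan_iff_atMost .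
  ultimately have "(\<lambda>N. (\<Prod>j<N. 1 - a * of_real q ^ j) * F (a * of_real q ^ N)) \<longlonglongrightarrow> qpoch_inf a q * 1"
    by (intro tendsto_mult) auto
  then have "F a = qpoch_inf a q"
    by (simp add: LIMSEQ_const_iff flip: F_iter)
  then show ?thesis
    unfolding F_def using summable by (simp add: sums_iff)
qed

section \<open>Products of absolutely convergent series\<close>

text \<open>Index vectors are identified with functions on the finite index type, where the
  distributive law for products of absolutely convergent sums applies.\<close>

lemma norm_summable_on_prod_vec:
  fixes u :: "'r::finite \<Rightarrow> nat \<Rightarrow> complex"
  assumes "\<And>s. (\<lambda>i. norm (u s i)) summable_on UNIV"
  shows "(\<lambda>i::nat^'r. norm (\<Prod>s\<in>UNIV. u s (i $ s))) summable_on UNIV"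
    and "(\<Sum>\<^sub>\<infinity>i::nat^'r. \<Prod>s\<in>UNIV. u s (i $ s)) = (\<Prod>s\<in>UNIV. \<Sum>\<^sub>\<infinity>i. u s i)"
proof -
  have bij: "bij_betw (\<lambda>i::nat^'r. ($) i) UNIV (PiE UNIV (\<lambda>_. UNIV))"
    by (rule bij_betwI[of _ _ _ vec_lambda]) auto
  have "(\<lambda>g. norm (\<Prod>s\<in>UNIV. u s (g s))) summable_on (PiE UNIV (\<lambda>_::'r. UNIV :: nat set))"
    using assms unfolding abs_summable_equivalent by (intro abs_summable_on_prod_PiE) auto
  then show "(\<lambda>i::nat^'r. norm (\<Prod>s\<in>UNIV. u s (i $ s))) summable_on UNIV"
    by (subst summable_on_reindex_bij_betw[OF bij])
  have "(\<Sum>\<^sub>\<infinity>g\<in>PiE UNIV (\<lambda>_::'r. UNIV :: nat set). \<Prod>s\<in>UNIV. u s (g s)) = (\<Prod>s\<in>UNIV. \<Sum>\<^sub>\<infinity>i. u s i)"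
    using assms by (intro infsum_prod_PiE_abs) auto
  then show "(\<Sum>\<^sub>\<infinity>i::nat^'r. \<Prod>s\<in>UNIV. u s (i $ s)) = (\<Prod>s\<in>UNIV. \<Sum>\<^sub>\<infinity>i. u s i)"
    by (subst infsum_reindex_bij_betw[OF bij])
qed

lemma norm_summable_on_Times:
  fixes f :: "'a \<Rightarrow> complex" and g :: "'b \<Rightarrow> complex"
  assumes "(\<lambda>x. norm (f x)) summable_on UNIV" "(\<lambda>y. norm (g y)) summable_on UNIV"
  shows "(\<lambda>(x, y). norm (f x * g y)) summable_on UNIV"
    and "(\<Sum>\<^sub>\<infinity>(x, y). f x * g y) = (\<Sum>\<^sub>\<infinity>x. f x) * (\<Sum>\<^sub>\<infinity>y. g y)"
proof -
  have "(\<lambda>p. norm (case p of (x, y) \<Rightarrow> f x * g y)) summable_on (UNIV \<times> UNIV)"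
    using assms unfolding Infinite_Sum.abs_summable_on_Sigma_iff
    by (auto simp: norm_mult abs_mult infsum_cmult_right' intro!: summable_on_cmult_right summable_on_cmult_left)
  then show sum: "(\<lambda>(x, y). norm (f x * g y)) summable_on UNIV"
    by (simp add: case_prod_unfold)
  have "(\<lambda>(x, y). f x * g y) summable_on (UNIV \<times> UNIV)"
    by (rule abs_summable_summable) (use sum in \<open>simp add: case_prod_unfold\<close>)
  from infsum_Sigma'_banach[OF this]
  show "(\<Sum>\<^sub>\<infinity>(x, y). f x * g y) = (\<Sum>\<^sub>\<infinity>x. f x) * (\<Sum>\<^sub>\<infinity>y. g y)"
    by (simp add: infsum_cmult_right' infsum_cmult_left')
qed

section \<open>The transformation formula\<close>

lemma qpoch_inf_shift:
  assumes "0 < q" "q < 1"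
  shows "qpoch_inf a q = (1 - a) * qpoch_inf (a * of_real q) q"
  by (rule trans[OF qpoch_inf_split[OF assms, of a 1]]) simp

text \<open>Unlike \<open>qpoch_eq_quotient\<close>, the nonvanishing condition is on
  \<open>qpoch_inf a q\<close>, so for negative \<open>n\<close> the right-hand side may be
  0.\<close>

lemma qpoch_inf_div_qpoch:
  assumes "0 < q" "q < 1" "qpoch_inf a q \<noteq> 0"
  shows "qpoch_inf a q / qpoch a q n = qpoch_inf (a * of_real q powi n) q"
proof (cases "n \<ge> 0")
  case True
  then show ?thesis
    using assms(3) qpoch_inf_split[OF assms(1,2), of a "nat n"]
    by (simp add: qpoch_def power_int_def)
next
  case False
  define m where "m = nat (- n)"
  have n: "n = - int m" and m: "m > 0"
    using False by (auto simp: m_def)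
  have "qpoch_inf (a / of_real q ^ m) q = (\<Prod>j=1..m. 1 - a / of_real q ^ j) * qpoch_inf a q" for m
  proof (induction m)
    case (Suc m)
    have "a / of_real q ^ Suc m * of_real q = a / of_real q ^ m"
      using assms by simp
    with Suc show ?case
      by (subst qpoch_inf_shift[OF assms(1,2)]) (simp add: mult_ac)
  qed simp
  \<comment> \<open>For negative \<open>n\<close>, dividing by \<open>qpoch\<close> multiplies by
    the finite product. This remains correct if that product is 0, because
    \<open>inverse 0 = 0\<close> and division by 0 gives 0.\<close>
  then show ?thesis
    using m by (simp add: n qpoch_def power_int_minus field_simps)
qed

text \<open>Each factor is reversed by \<open>(1 - q^j / y) * (- y) = q^j * (1 - y / q^j)\<close>.
  The powers of \<open>q\<close> collect to the binomial exponent, and the reversed factors extend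
  the product starting at \<open>q * y\<close> down to \<open>y * q powi (1 - n)\<close>.\<close>

lemma qpoch_inverse_reflect:
  assumes q: "0 < q" "q < 1" and y: "y \<noteq> 0" "qpoch_inf (of_real q * y) q \<noteq> 0"
  shows "qpoch (1 / y) q n * (- y) powi n * qpoch_inf (of_real q * y) q =
    of_real (q powr (of_int n gchoose 2)) * qpoch_inf (y * of_real q powi (1 - n)) q"
proof (cases "n \<ge> 0")
  case True
  define m where "m = nat n"
  have n: "n = int m"
    using True by (simp add: m_def)
  have "(\<Prod>j<m. 1 - 1 / y * of_real q ^ j) * (- y) ^ m * qpoch_inf (of_real q * y) q =
    of_real (q powr (of_nat m gchoose 2)) * qpoch_inf (y * of_real q powi (1 - int m)) q"
  proof (induction m)
    case 0
    then show ?case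
      by (simp add: gbinomial_prod_rev numeral_2_eq_2 mult_ac q(1)[THEN less_imp_neq, symmetric])
  next
    case (Suc m)
    have "(of_nat (Suc m) gchoose 2 :: real) = (of_nat m gchoose 2) + real m"
      by (simp add: gbinomial_prod_rev numeral_2_eq_2 field_simps)
    then have p: "q powr (of_nat (Suc m) gchoose 2) = q powr (of_nat m gchoose 2) * q ^ m"
      using q by (simp add: powr_add powr_realpow)
    have s: "qpoch_inf (y * of_real q powi (1 - int (Suc m))) q =
      (1 - y / of_real q ^ m) * qpoch_inf (y * of_real q powi (1 - int m)) q"
      using q by (subst qpoch_inf_shift) (auto simp: power_int_diff power_int_minus divide_simps)
    have "(\<Prod>j<Suc m. 1 - 1 / y * of_real q ^ j) * (- y) ^ Suc m * qpoch_inf (of_real q * y) q =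
       (1 - 1 / y * of_real q ^ m) * (- y) * (of_real (q powr (of_nat m gchoose 2)) * qpoch_inf (y * of_real q powi (1 - int m)) q)"
      unfolding Suc[symmetric] by simp
    also have "(1 - 1 / y * of_real q ^ m) * (- y) = of_real q ^ m * (1 - y / of_real q ^ m)"
      using y q by (simp add: field_simps)
    finally show ?case
      unfolding p s by simp
  qed
  then show ?thesis
    by (simp add: n qpoch_def)
next
  case False
  define m where "m = nat (- n)"
  have n: "n = - int m" and m: "m > 0"
    using False by (auto simp: m_def)
  \<comment> \<open>Multiplied out, with the finite product in place of its inverse; afterwards
    \<open>y(2)\<close> forces that product to be nonzero, and it can be cancelled.\<close>
  have *: "qpoch_inf (of_real q * y) q = (\<Prod>j=1..m. 1 - 1 / y / of_real q ^ j) * (- y) ^ m *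
      of_real (q powr (of_int (- int m) gchoose 2)) * qpoch_inf (y * of_real q ^ Suc m) q" for m
  proof (induction m)
    case 0
    then show ?case
      by (simp add: gbinomial_prod_rev numeral_2_eq_2 mult_ac q(1)[THEN less_imp_neq, symmetric])
  next
    case (Suc m)
    have "(of_int (- int (Suc m)) gchoose 2 :: real) = (of_int (- int m) gchoose 2) + real (Suc m)"
      by (simp add: gbinomial_prod_rev numeral_2_eq_2 field_simps)
    then have p: "q powr (of_int (- int (Suc m)) gchoose 2) = q powr (of_int (- int m) gchoose 2) * q ^ Suc m"
      using q by (simp only: powr_add powr_realpow)
    have s: "qpoch_inf (y * of_real q ^ Suc m) q =
      (1 - y * of_real q ^ Suc m) * qpoch_inf (y * of_real q ^ Suc (Suc m)) q"
      using q by (subst qpoch_inf_shift) (auto simp: mult_ac)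
    have "1 - y * of_real q ^ Suc m = (1 - 1 / y / of_real q ^ Suc m) * (- y) * of_real q ^ Suc m"
      using y q by (simp add: field_simps)
    with Suc show ?case
      unfolding p s by simp
  qed
  define P where "P = (\<Prod>j=1..m. 1 - 1 / y / of_real q ^ j)"
  have "complex_of_real q powi (1 - n) = of_real q ^ Suc m"
    using q by (simp add: n power_int_add)
  then have eq: "qpoch_inf (of_real q * y) q = P * (- y) ^ m *
      of_real (q powr (of_int n gchoose 2)) * qpoch_inf (y * of_real q powi (1 - n)) q"
    unfolding P_def by (simp only: *[of m] n)
  then have nz: "P \<noteq> 0" "(- y) ^ m \<noteq> 0"
    using y by auto
  have "qpoch (1 / y) q n = inverse P"
    using m by (simp add: qpoch_def n P_def)
  moreover have "(- y) powi n = inverse ((- y) ^ m)"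
    by (simp add: n power_int_minus)
  moreover have "inverse A * inverse B * (A * B * R * T) = R * T" if "A \<noteq> 0" "B \<noteq> 0" for A B R T :: complex
    using that by (simp add: field_simps)
  ultimately show ?thesis
    unfolding eq using nz by (simp only:)
qed

text \<open>Each of the \<open>CARD('r)\<close> reflections contributes one binomial power of
  \<open>q\<close>, which raises \<open>\<alpha> - real CARD('r)\<close> to \<open>\<alpha>\<close>.
  The numerators are now infinite products, ready for Euler's expansion.\<close>

lemma L_term_eq:
  fixes x y :: "complex ^ 'r"
  assumes q: "0 < q" "q < 1" and y: "\<And>s. y $ s \<noteq> 0"
    and nz: "\<And>s. qpoch_inf (x $ s) q \<noteq> 0" "\<And>s. qpoch_inf (of_real q * y $ s) q \<noteq> 0"
  shows "L_term \<alpha> x y q w n * (\<Prod>s\<in>UNIV. qpoch_inf (x $ s) q * qpoch_inf (of_real q * y $ s) q) =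
    w powi n * of_real (q powr (\<alpha> * (of_int n gchoose 2))) *
    (\<Prod>s\<in>UNIV. qpoch_inf (x $ s * of_real q powi n) q * qpoch_inf (y $ s * of_real q powi (1 - n)) q)"
proof -
  have "(\<Prod>s\<in>UNIV. qpoch (1 / y $ s) q n * (- (y $ s)) powi n / qpoch (x $ s) q n) *
        (\<Prod>s\<in>UNIV. qpoch_inf (x $ s) q * qpoch_inf (of_real q * y $ s) q) =
        (\<Prod>s\<in>UNIV. (qpoch (1 / y $ s) q n * (- (y $ s)) powi n * qpoch_inf (of_real q * y $ s) q) *
                    (qpoch_inf (x $ s) q / qpoch (x $ s) q n))"
    by (simp add: mult_ac flip: prod.distrib)
  also have "\<dots> = (\<Prod>s\<in>(UNIV::'r set). of_real (q powr (of_int n gchoose 2)) *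
        (qpoch_inf (x $ s * of_real q powi n) q * qpoch_inf (y $ s * of_real q powi (1 - n)) q))"
    by (simp only: qpoch_inverse_reflect[OF q y nz(2)] qpoch_inf_div_qpoch[OF q nz(1)]) (simp only: mult_ac)
  also have "\<dots> = of_real (q powr (real CARD('r) * (of_int n gchoose 2))) *
     (\<Prod>s\<in>UNIV. qpoch_inf (x $ s * of_real q powi n) q * qpoch_inf (y $ s * of_real q powi (1 - n)) q)"
    using q by (simp add: prod.distrib powr_powr[symmetric] powr_realpow mult.commute[of "real _"])
  finally have *: "(\<Prod>s\<in>UNIV. qpoch (1 / y $ s) q n * (- (y $ s)) powi n / qpoch (x $ s) q n) *
        (\<Prod>s\<in>UNIV. qpoch_inf (x $ s) q * qpoch_inf (of_real q * y $ s) q) = \<dots>" .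
  have "q powr (\<alpha> * (of_int n gchoose 2)) = q powr ((\<alpha> - real CARD('r)) * (of_int n gchoose 2)) *
      q powr (real CARD('r) * (of_int n gchoose 2))"
    by (simp add: algebra_simps flip: powr_add)
  then show ?thesis
    unfolding L_term_def mult.assoc * by simp
qed

section \<open>Absolute convergence of H\<close>

lemma Q_ge:
  fixes i j :: "nat ^ 'r"
  assumes "\<alpha> > 0"
  shows "Q \<alpha> i j \<ge> (1 - real CARD('r) / \<alpha>) * (\<Sum>s\<in>UNIV. (real (i $ s))\<^sup>2 + (real (j $ s))\<^sup>2)"
proof -
  define I J where "I = (\<Sum>s\<in>UNIV. real (i $ s))" and "J = (\<Sum>s\<in>UNIV. real (j $ s))"
  have "I \<ge> 0" "J \<ge> 0"
    by (auto simp: I_def J_def intro: sum_nonneg)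
  then have "0 \<le> I * J"
    by simp
  then have "(I - J)\<^sup>2 \<le> I\<^sup>2 + J\<^sup>2"
    by (simp add: power2_eq_square algebra_simps)
  also have "\<dots> \<le> real CARD('r) * (\<Sum>s\<in>UNIV. (real (i $ s))\<^sup>2 + (real (j $ s))\<^sup>2)"
    unfolding I_def J_def sum.distrib distrib_left
    using sum_squared_le_sum_of_squares[of "\<lambda>s. real (i $ s)" UNIV]
          sum_squared_le_sum_of_squares[of "\<lambda>s. real (j $ s)" UNIV]
    by (simp add: mult_ac)
  finally have "(I - J)\<^sup>2 / \<alpha> \<le> real CARD('r) * (\<Sum>s\<in>UNIV. (real (i $ s))\<^sup>2 + (real (j $ s))\<^sup>2) / \<alpha>"
    using assms by (intro divide_right_mono) auto
  then show ?thesis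
    unfolding Q_def I_def J_def by (simp add: sum_subtractf algebra_simps)
qed

lemma norm_summable_on_H_term:
  fixes x y :: "complex ^ 'r"
  assumes q: "0 < q" "q < 1" and \<alpha>: "\<alpha> > real CARD('r)"
  shows "(\<lambda>(i, j). norm (H_term \<alpha> x y q i j)) summable_on UNIV"
proof -
  \<comment> \<open>Half the constant of \<open>Q_ge\<close>, since \<open>H_term\<close> contains
    \<open>q\<close> to the power \<open>Q / 2\<close>.\<close>
  define \<delta> where "\<delta> = (1 - real CARD('r) / \<alpha>) / 2"
  have \<alpha>0: "\<alpha> > 0"
    using \<alpha> by (rule order.strict_trans1[rotated]) simp
  have \<delta>: "\<delta> > 0"
    using \<alpha> \<alpha>0 by (simp add: \<delta>_def)
  define u where "u c i = of_real (q powr (\<delta> * (real i)\<^sup>2)) * c ^ i / qpoch (of_real q) q (int i)" for c :: complex and i :: nat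
  have u: "(\<lambda>i. norm (u c i)) summable_on UNIV" for c
    unfolding u_def using summable_norm_q_exponential[OF q \<delta>]
    by (intro norm_summable_imp_summable_on) simp
  have "(\<lambda>(i::nat^'r, j::nat^'r). norm ((\<Prod>s\<in>UNIV. u (- (x $ s)) (i $ s)) * (\<Prod>s\<in>UNIV. u (- (y $ s)) (j $ s))))
      summable_on UNIV"
    by (intro norm_summable_on_Times norm_summable_on_prod_vec u)
  then show ?thesis
  proof (rule summable_on_comparison_test)
    fix p :: "(nat ^ 'r) \<times> (nat ^ 'r)"
    obtain i j where p: "p = (i, j)"
      by force
    define P where "P = norm ((\<Prod>s\<in>UNIV. (- (x $ s)) ^ (i $ s) * (- (y $ s)) ^ (j $ s)) /
     (\<Prod>s\<in>UNIV. qpoch (of_real q) q (int (i $ s)) * qpoch (of_real q) q (int (j $ s))))"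
    have "(\<Prod>s\<in>UNIV. u (- (x $ s)) (i $ s)) * (\<Prod>s\<in>UNIV. u (- (y $ s)) (j $ s)) =
      of_real (\<Prod>s\<in>UNIV. q powr (\<delta> * (real (i $ s))\<^sup>2) * q powr (\<delta> * (real (j $ s))\<^sup>2)) *
       ((\<Prod>s\<in>UNIV. (- (x $ s)) ^ (i $ s) * (- (y $ s)) ^ (j $ s)) /
     (\<Prod>s\<in>UNIV. qpoch (of_real q) q (int (i $ s)) * qpoch (of_real q) q (int (j $ s))))"
      by (simp add: u_def prod.distrib prod_dividef)
    also have "(\<Prod>s\<in>UNIV. q powr (\<delta> * (real (i $ s))\<^sup>2) * q powr (\<delta> * (real (j $ s))\<^sup>2)) =
      q powr (\<delta> * (\<Sum>s\<in>UNIV. (real (i $ s))\<^sup>2 + (real (j $ s))\<^sup>2))"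
      using q by (simp add: powr_sum powr_add sum_distrib_left distrib_left)
    finally have *: "norm ((\<Prod>s\<in>UNIV. u (- (x $ s)) (i $ s)) * (\<Prod>s\<in>UNIV. u (- (y $ s)) (j $ s))) =
        q powr (\<delta> * (\<Sum>s\<in>UNIV. (real (i $ s))\<^sup>2 + (real (j $ s))\<^sup>2)) * P"
      by (simp only: norm_mult P_def norm_of_real) simp
    have "\<delta> * (\<Sum>s\<in>UNIV. (real (i $ s))\<^sup>2 + (real (j $ s))\<^sup>2) \<le> 1 / 2 * Q \<alpha> i j"
      using Q_ge[OF \<alpha>0, of i j] by (simp add: \<delta>_def)
    then have "q powr (1 / 2 * Q \<alpha> i j) * P \<le> q powr (\<delta> * (\<Sum>s\<in>UNIV. (real (i $ s))\<^sup>2 + (real (j $ s))\<^sup>2)) * P"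
      using q by (intro mult_right_mono powr_mono') (auto simp: P_def)
    moreover have "norm (H_term \<alpha> x y q i j) = q powr (1 / 2 * Q \<alpha> i j) * P"
      by (simp add: H_term_def P_def norm_mult norm_divide)
    ultimately show "(case p of (i, j) \<Rightarrow> norm (H_term \<alpha> x y q i j)) \<le>
       (case p of (i, j) \<Rightarrow> norm ((\<Prod>s\<in>UNIV. u (- (x $ s)) (i $ s)) * (\<Prod>s\<in>UNIV. u (- (y $ s)) (j $ s))))"
      by (simp add: p *)
  qed auto
qed

section \<open>Phases and centres of the Gaussians\<close>

text \<open>Rotating \<open>x\<close> and \<open>y\<close> in opposite directions produces a phase
  depending only on the difference of the index sums, exactly the quantity in the centre of the
  Gaussian.\<close>

lemma H_term_rotate:
  fixes x y :: "complex ^ 'r"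
  shows "H_term \<alpha> (exp \<theta> *s x) (exp (- \<theta>) *s y) q i j =
    H_term \<alpha> x y q i j * exp (\<theta> * of_real (\<Sum>s\<in>UNIV. real (i $ s) - real (j $ s)))"
proof -
  have "(- (exp \<theta> * x $ s)) ^ (i $ s) * (- (exp (- \<theta>) * y $ s)) ^ (j $ s) =
      (- (x $ s)) ^ (i $ s) * (- (y $ s)) ^ (j $ s) * exp (\<theta> * of_real (real (i $ s) - real (j $ s)))" for s
  proof -
    have "exp (\<theta> * of_real (real (i $ s) - real (j $ s))) = exp \<theta> ^ (i $ s) * exp (- \<theta>) ^ (j $ s)"
      by (simp add: right_diff_distrib exp_diff exp_of_nat2_mult exp_minus divide_inverse power_inverse)
    then show ?thesis
      using power_mult_distrib[of "exp \<theta>" "- (x $ s)" "i $ s"] power_mult_distrib[of "exp (- \<theta>)" "- (y $ s)" "j $ s"]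
      by (simp add: mult_ac)
  qed
  then show ?thesis
    by (simp add: H_term_def prod.distrib exp_sum sum_distrib_left)
qed

text \<open>Completing the square in \<open>n\<close> separates a Gaussian in \<open>n\<close> from the term of \<open>H\<close>.\<close>
lemma euler_expansion_complete_square:
  fixes x y :: "complex ^ 'r" and i j :: "nat ^ 'r" and n :: int
  assumes t: "t > 0" and q: "q = exp (- t)" and z: "z > 0" and \<alpha>: "\<alpha> > 0"
  defines "d \<equiv> \<Sum>s\<in>UNIV. real (i $ s) - real (j $ s)"
  shows "of_real (z powr \<alpha>) powi n * of_real (q powr (\<alpha> * (of_int n gchoose 2))) *
     ((\<Prod>s\<in>UNIV. euler_term q (of_real z * x $ s * of_real q powi n) (i $ s)) *
      (\<Prod>s\<in>UNIV. euler_term q (of_real (inverse z) * y $ s * of_real q powi (1 - n)) (j $ s))) =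
    H_term \<alpha> x y q i j *
    of_real (exp (\<alpha> * t / 8 + \<alpha> / 2 * ln z + \<alpha> / (2 * t) * (ln z)\<^sup>2) *
             exp (- (\<alpha> * t / 2) * (of_int n + (d / \<alpha> - 1 / 2 - ln z / t))\<^sup>2))"
proof -
  have powi: "complex_of_real q powi k = of_real (exp (- t * of_int k))" for k
    by (simp add: q powr_real_of_int'[symmetric] powr_def flip: of_real_power_int)
  have zexp: "complex_of_real z = of_real (exp (ln z))" "complex_of_real (inverse z) = of_real (exp (- ln z))"
    using z by (simp_all add: exp_minus)
  have et: "euler_term q (of_real (exp \<gamma>) * c) k =
      of_real (exp (- t * (real k * (real k - 1) / 2) + \<gamma> * real k)) * ((- c) ^ k / qpoch (of_real q) q (int k))" for \<gamma> c k
  proof -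
    have "(- (of_real (exp \<gamma>) * c)) ^ k = of_real (exp (\<gamma> * real k)) * (- c) ^ k"
      using power_mult_distrib[of "of_real (exp \<gamma>)" "- c" k] by (simp add: exp_of_nat2_mult)
    moreover have "q powr (real k * (real k - 1) / 2) = exp (- t * (real k * (real k - 1) / 2))"
      by (simp add: q powr_def)
    ultimately show ?thesis
      unfolding euler_term_def exp_add by (simp only:) simp
  qed
  have etx: "euler_term q (of_real z * c * of_real q powi n) k =
    of_real (exp (- t * (real k * (real k - 1) / 2) + (ln z - t * of_int n) * real k)) * ((- c) ^ k / qpoch (of_real q) q (int k))" for c k
  proof -
    have "of_real z * c * of_real q powi n = of_real (exp (ln z) * exp (- t * of_int n)) * c"
      unfolding zexp powi by simp
    also have "exp (ln z) * exp (- t * of_int n) = exp (ln z - t * of_int n)"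
      unfolding exp_add[symmetric] by simp
    finally show ?thesis
      by (simp only: et)
  qed
  have ety: "euler_term q (of_real (inverse z) * c * of_real q powi (1 - n)) k =
    of_real (exp (- t * (real k * (real k - 1) / 2) + (- ln z - t * (1 - of_int n)) * real k)) * ((- c) ^ k / qpoch (of_real q) q (int k))" for c k
  proof -
    have "of_real (inverse z) * c * of_real q powi (1 - n) = of_real (exp (- ln z) * exp (- t * of_int (1 - n))) * c"
      unfolding zexp powi by simp
    also have "exp (- ln z) * exp (- t * of_int (1 - n)) = exp (- ln z - t * (1 - of_int n))"
      unfolding exp_add[symmetric] by simp
    finally show ?thesis
      by (simp only: et)
  qed
  define S I J where "S = (\<Sum>s\<in>UNIV. (real (i $ s))\<^sup>2 + (real (j $ s))\<^sup>2)"
    and "I = (\<Sum>s\<in>UNIV. real (i $ s))" and "J = (\<Sum>s\<in>UNIV. real (j $ s))"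
  have d: "d = I - J"
    by (simp add: d_def I_def J_def sum_subtractf)
  define X where "X = (\<Sum>s\<in>UNIV. - t * (real (i $ s) * (real (i $ s) - 1) / 2) + (ln z - t * of_int n) * real (i $ s))"
  define Y where "Y = (\<Sum>s\<in>UNIV. - t * (real (j $ s) * (real (j $ s) - 1) / 2) + (- ln z - t * (1 - of_int n)) * real (j $ s))"
  \<comment> \<open>The extra \<open>- t * J\<close> from \<open>q powi (1 - n)\<close> turns
    \<open>t / 2 * (I + J)\<close> into \<open>t / 2 * (I - J)\<close>, so beyond \<open>S\<close>
    only the difference \<open>d\<close> matters.\<close>
  have XY: "X + Y = - t / 2 * (S - I - J) + (ln z - t * of_int n) * I + (- ln z - t * (1 - of_int n)) * J"
    unfolding X_def Y_def S_def I_def J_def sum_distrib_left sum_subtractf[symmetric] sum.distrib[symmetric]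
    by (rule sum.cong) (auto simp: power2_eq_square field_simps)
  define P where "P = (\<Prod>s\<in>UNIV. (- (x $ s)) ^ (i $ s) * (- (y $ s)) ^ (j $ s)) /
     (\<Prod>s\<in>UNIV. qpoch (of_real q) q (int (i $ s)) * qpoch (of_real q) q (int (j $ s)))"
  have prods: "(\<Prod>s\<in>UNIV. euler_term q (of_real z * x $ s * of_real q powi n) (i $ s)) *
      (\<Prod>s\<in>UNIV. euler_term q (of_real (inverse z) * y $ s * of_real q powi (1 - n)) (j $ s)) = of_real (exp X * exp Y) * P"
    unfolding etx ety X_def Y_def P_def exp_sum[OF finite] of_real_mult of_real_prod
    by (simp only: prod.distrib prod_dividef) (simp add: mult_ac)
  have zn: "complex_of_real (z powr \<alpha>) powi n = of_real (exp (\<alpha> * ln z * of_int n))"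
    using z by (simp add: powr_real_of_int'[symmetric] powr_def mult_ac flip: of_real_power_int)
  have qn: "q powr (\<alpha> * (of_int n gchoose 2)) = exp (- t * (\<alpha> * (of_int n * (of_int n - 1) / 2)))"
    by (simp add: q powr_def gbinomial_prod_rev numeral_2_eq_2 mult_ac)
  have H: "H_term \<alpha> x y q i j = of_real (exp (- t / 2 * (S - d\<^sup>2 / \<alpha>))) * P"
    by (simp add: H_term_def P_def Q_def S_def d_def q powr_def)
  \<comment> \<open>The constant of the expanded square is undone by the first bracket and its
    \<open>d^2\<close> part by that of \<open>Q\<close>; its terms linear in \<open>d\<close> are
    those of \<open>X + Y\<close>.\<close>
  have "\<alpha> * ln z * of_int n + - t * (\<alpha> * (of_int n * (of_int n - 1) / 2)) + (X + Y) =
     - t / 2 * (S - d\<^sup>2 / \<alpha>) + ((\<alpha> * t / 8 + \<alpha> / 2 * ln z + \<alpha> / (2 * t) * (ln z)\<^sup>2) +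
     (- (\<alpha> * t / 2) * (of_int n + (d / \<alpha> - 1 / 2 - ln z / t))\<^sup>2))"
    unfolding XY d using t \<alpha> by (simp add: field_simps power2_eq_square)
  then have "exp (\<alpha> * ln z * of_int n) * exp (- t * (\<alpha> * (of_int n * (of_int n - 1) / 2))) * (exp X * exp Y) =
     exp (- t / 2 * (S - d\<^sup>2 / \<alpha>)) * (exp (\<alpha> * t / 8 + \<alpha> / 2 * ln z + \<alpha> / (2 * t) * (ln z)\<^sup>2) *
     exp (- (\<alpha> * t / 2) * (of_int n + (d / \<alpha> - 1 / 2 - ln z / t))\<^sup>2))"
    unfolding exp_add[symmetric] by (rule arg_cong)
  moreover have "of_real A * of_real B * (of_real C * P) = of_real (A * B * C) * P"
    "of_real A * P * of_real B = of_real (A * B) * P" for A B C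
    by simp_all
  ultimately show ?thesis
    unfolding prods zn qn H by (simp only:)
qed

section \<open>Exchanging the order of summation\<close>

text \<open>The summability conjuncts give the equation its content, since \<open>infsum\<close> is
  0 on families that are not summable. The last two assumptions keep the denominator of the
  prefactor nonzero.\<close>

theorem theorem1p7:
  fixes t q z \<alpha> :: real and x y :: "complex ^ 'r"
  assumes "t > 0" and "q = exp (- t)" and "z > 0"
    and "\<And>s. x $ s \<noteq> 0" and "\<And>s. y $ s \<noteq> 0"
    and "\<alpha> > real CARD('r)"
    and "\<And>s. qpoch_inf (of_real z * x $ s) q \<noteq> 0"
    and "\<And>s. qpoch_inf (of_real q * of_real (inverse z) * y $ s) q \<noteq> 0"
  shows "L_term \<alpha> (of_real z *s x) (of_real (inverse z) *s y) q (of_real (z powr \<alpha>))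
           summable_on UNIV
    \<and> (\<forall>n::int. (\<lambda>(i, j). H_term \<alpha> (exp (2 * of_real pi * \<i> * of_int n / of_real \<alpha>) *s x)
                                (exp (- 2 * of_real pi * \<i> * of_int n / of_real \<alpha>) *s y) q i j)
           summable_on UNIV)
    \<and> (\<lambda>n::int. H \<alpha> (exp (2 * of_real pi * \<i> * of_int n / of_real \<alpha>) *s x)
                    (exp (- 2 * of_real pi * \<i> * of_int n / of_real \<alpha>) *s y) q *
                  exp (2 * of_real pi * \<i> * of_int n * (1 / 2 - 1 / of_real t * of_real (ln z))
                       - 2 * of_real pi ^ 2 * of_int n ^ 2 / (of_real \<alpha> * of_real t)))
           summable_on UNIV
    \<and> L \<alpha> (of_real z *s x) (of_real (inverse z) *s y) q (of_real (z powr \<alpha>)) =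
        of_real (sqrt (2 * pi * z powr \<alpha> / (\<alpha> * t)) * exp (\<alpha> * t / 8 + \<alpha> / (2 * t) * (ln z)\<^sup>2)) /
        (\<Prod>s\<in>UNIV. qpoch_inf (of_real z * x $ s) q *
                   qpoch_inf (of_real q * of_real (inverse z) * y $ s) q) *
        (\<Sum>\<^sub>\<infinity>n::int. H \<alpha> (exp (2 * of_real pi * \<i> * of_int n / of_real \<alpha>) *s x)
                        (exp (- 2 * of_real pi * \<i> * of_int n / of_real \<alpha>) *s y) q *
                      exp (2 * of_real pi * \<i> * of_int n * (1 / 2 - 1 / of_real t * of_real (ln z))
                           - 2 * of_real pi ^ 2 * of_int n ^ 2 / (of_real \<alpha> * of_real t)))"
proof -
  have q: "0 < q" "q < 1"
    using assms(1,2) by auto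
  have \<alpha>0: "\<alpha> > 0"
    using assms(6) by (rule order.strict_trans1[rotated]) simp
  define a where "a = \<alpha> * t / 2"
  have a: "a > 0"
    using \<alpha>0 assms(1) by (simp add: a_def)
  define d where "d = (\<lambda>(i, j). \<Sum>s\<in>UNIV. real ((i :: nat ^ 'r) $ s) - real ((j :: nat ^ 'r) $ s))"
  define b where "b p = d p / \<alpha> - 1 / 2 - ln z / t" for p
  define K where "K = exp (\<alpha> * t / 8 + \<alpha> / 2 * ln z + \<alpha> / (2 * t) * (ln z)\<^sup>2)"
  define A where "A = (\<lambda>(i, j). H_term \<alpha> x y q i j)"
  define E where "E m = exp (- pi\<^sup>2 * (of_int m)\<^sup>2 / a)" for m :: int
  define P where "P = (\<Prod>s\<in>UNIV. qpoch_inf (of_real z * x $ s) q * qpoch_inf (of_real q * of_real (inverse z) * y $ s) q)"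
  \<comment> \<open>\<open>T\<close> is the Euler expansion after completing the square and
    \<open>U\<close> its Poisson dual, so for each \<open>p\<close> both have the same sum over the
    integer index. Summed over \<open>p\<close> instead, \<open>T\<close> gives the terms of
    \<open>L\<close> times \<open>P\<close>, and \<open>U\<close> gives \<open>R\<close> up to a
    constant.\<close>
  define T where "T p n = A p * of_real (K * exp (- a * (of_int n + b p)\<^sup>2))" for p and n :: int
  define U where "U p m = A p * (of_real (K * sqrt (pi / a) * E m) * cis (2 * pi * of_int m * b p))" for p and m :: int
  define R where "R m = H \<alpha> (exp (2 * of_real pi * \<i> * of_int m / of_real \<alpha>) *s x)
      (exp (- 2 * of_real pi * \<i> * of_int m / of_real \<alpha>) *s y) q *
      exp (2 * of_real pi * \<i> * of_int m * (1 / 2 - 1 / of_real t * of_real (ln z))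
                       - 2 * of_real pi ^ 2 * of_int m ^ 2 / (of_real \<alpha> * of_real t))" for m :: int
  let ?L = "L_term \<alpha> (of_real z *s x) (of_real (inverse z) *s y) q (of_real (z powr \<alpha>))"
  have P: "P \<noteq> 0"
    using assms(7,8) by (simp add: P_def)
  have K: "K > 0"
    by (simp add: K_def)
  have A_summable: "(\<lambda>p. norm (A p)) summable_on UNIV"
    using norm_summable_on_H_term[OF q assms(6), of x y] by (simp add: A_def case_prod_unfold)
  have E_summable: "E summable_on UNIV"
    unfolding E_def using summable_on_gaussian[of "pi\<^sup>2 / a"] a by (simp add: mult_ac)
  have inner: "(\<lambda>n::int. exp (- a * (of_int n + b p)\<^sup>2)) summable_on UNIV" for p
    by (rule summable_on_gaussian_translate[OF a])

  have T_summable: "(\<lambda>(p, n). T p n) summable_on UNIV \<times> UNIV"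
  proof (rule abs_summable_summable, unfold Infinite_Sum.abs_summable_on_Sigma_iff, intro conjI ballI)
    have norm_T: "norm (T p n) = norm (A p) * K * exp (- a * (of_int n + b p)\<^sup>2)" for p n
      using K by (simp add: T_def norm_mult)
    show "(\<lambda>n. norm (case (p, n) of (p, n) \<Rightarrow> T p n)) summable_on UNIV" for p
      unfolding prod.case norm_T by (intro summable_on_cmult_right inner)
    \<comment> \<open>\<open>\<Theta>\<close> is independent of the centre \<open>b p\<close>, so
      summability over \<open>p\<close> reduces to that of \<open>A\<close>.\<close>
    define \<Theta> where "\<Theta> = sqrt (pi / a) * (\<Sum>\<^sub>\<infinity>m. E m)"
    have bound: "norm (\<Sum>\<^sub>\<infinity>n. norm (case (p, n) of (p, n) \<Rightarrow> T p n)) \<le> norm (A p) * (K * \<Theta>)" for p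
    proof -
      have "norm (\<Sum>\<^sub>\<infinity>n. norm (case (p, n) of (p, n) \<Rightarrow> T p n)) =
          norm (A p) * K * (\<Sum>\<^sub>\<infinity>n. exp (- a * (of_int n + b p)\<^sup>2))"
        unfolding prod.case norm_T infsum_cmult_right' using K by (simp add: abs_mult infsum_nonneg)
      also have "\<dots> \<le> norm (A p) * K * \<Theta>"
        unfolding \<Theta>_def E_def using K by (intro mult_left_mono infsum_gaussian_translate_le a) auto
      finally show ?thesis
        by (simp add: mult_ac)
    qed
    show "(\<lambda>p. norm (\<Sum>\<^sub>\<infinity>n. norm (case (p, n) of (p, n) \<Rightarrow> T p n))) summable_on UNIV"
      by (rule Infinite_Sum.abs_summable_on_comparison_test'[OF summable_on_cmult_left[OF A_summable] bound])
  qed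
  have T_sum: "(\<Sum>\<^sub>\<infinity>n. T p n) = (\<Sum>\<^sub>\<infinity>m. U p m)" for p
  proof -
    have "(\<Sum>\<^sub>\<infinity>n. T p n) = A p * (of_real K * (\<Sum>\<^sub>\<infinity>n::int. of_real (exp (- a * (of_int n + b p)\<^sup>2))))"
      unfolding T_def of_real_mult infsum_cmult_right' ..
    also have "\<dots> = (\<Sum>\<^sub>\<infinity>m. A p * (of_real K * (of_real (sqrt (pi / a)) * (of_real (E m) * cis (2 * pi * of_int m * b p)))))"
      unfolding gaussian_poisson_summation[OF a] E_def infsum_cmult_right' ..
    also have "\<dots> = (\<Sum>\<^sub>\<infinity>m. U p m)"
      by (simp add: U_def mult.assoc)
    finally show ?thesis .
  qed
  have U_summable: "(\<lambda>(p, m). U p m) summable_on UNIV \<times> UNIV"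
  proof (rule abs_summable_summable)
    \<comment> \<open>The phase has modulus 1, so the norm of \<open>U p m\<close> factors into a
      function of \<open>p\<close> and one of \<open>m\<close>.\<close>
    have "norm (complex_of_real (K * sqrt (pi / a) * E m)) = K * sqrt (pi / a) * E m" for m
      using a K by (simp only: norm_of_real) (simp add: E_def abs_mult)
    then have "(\<lambda>m. norm (complex_of_real (K * sqrt (pi / a) * E m))) summable_on UNIV"
      by (simp only: summable_on_cmult_right E_summable)
    from norm_summable_on_Times(1)[OF A_summable this]
    show "(\<lambda>p. norm (case p of (p, m) \<Rightarrow> U p m)) summable_on UNIV \<times> UNIV"
      by (simp add: U_def norm_mult case_prod_unfold)
  qed
  have L_term_sum: "(\<Sum>\<^sub>\<infinity>p. T p n) = ?L n * P" for n
  proof -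
    let ?u = "\<lambda>s. euler_term q (of_real z * x $ s * of_real q powi n)"
    let ?v = "\<lambda>s. euler_term q (of_real (inverse z) * y $ s * of_real q powi (1 - n))"
    have euler: "(\<lambda>i. norm (euler_term q c i)) summable_on UNIV" "(\<Sum>\<^sub>\<infinity>i. euler_term q c i) = qpoch_inf c q" for c
    proof -
      show "(\<lambda>i. norm (euler_term q c i)) summable_on UNIV"
        using summable_norm_euler_term[OF q] by (intro norm_summable_imp_summable_on) simp
      show "(\<Sum>\<^sub>\<infinity>i. euler_term q c i) = qpoch_inf c q"
        using norm_summable_imp_has_sum[OF summable_norm_euler_term[OF q] euler_term_sums[OF q]]
        by (rule infsumI)
    qed
    \<comment> \<open>The completed square is read backwards, and the Euler series are resummed to
      infinite products.\<close>
    have "(\<Sum>\<^sub>\<infinity>p. T p n) = (\<Sum>\<^sub>\<infinity>(i, j). of_real (z powr \<alpha>) powi n * of_real (q powr (\<alpha> * (of_int n gchoose 2))) *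
         ((\<Prod>s\<in>UNIV. ?u s (i $ s)) * (\<Prod>s\<in>UNIV. ?v s (j $ s))))"
      unfolding euler_expansion_complete_square[OF assms(1-3) \<alpha>0]
      by (simp add: T_def A_def K_def a_def b_def d_def case_prod_unfold)
    also have "\<dots> = of_real (z powr \<alpha>) powi n * of_real (q powr (\<alpha> * (of_int n gchoose 2))) *
        (\<Sum>\<^sub>\<infinity>(i, j). (\<Prod>s\<in>UNIV. ?u s (i $ s)) * (\<Prod>s\<in>UNIV. ?v s (j $ s)))"
      unfolding case_prod_unfold by (rule infsum_cmult_right')
    also have "(\<Sum>\<^sub>\<infinity>(i, j). (\<Prod>s\<in>UNIV. ?u s (i $ s)) * (\<Prod>s\<in>UNIV. ?v s (j $ s))) =
        (\<Prod>s\<in>UNIV. qpoch_inf (of_real z * x $ s * of_real q powi n) q) *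
        (\<Prod>s\<in>UNIV. qpoch_inf (of_real (inverse z) * y $ s * of_real q powi (1 - n)) q)"
      using norm_summable_on_Times(2)[OF norm_summable_on_prod_vec(1)[of ?u, OF euler(1)]
              norm_summable_on_prod_vec(1)[of ?v, OF euler(1)]]
      unfolding norm_summable_on_prod_vec(2)[of ?u, OF euler(1)] norm_summable_on_prod_vec(2)[of ?v, OF euler(1)]
        euler(2) .
    also have "of_real (z powr \<alpha>) powi n * of_real (q powr (\<alpha> * (of_int n gchoose 2))) * \<dots> = ?L n * P"
    proof -
      have "(of_real (inverse z) *s y) $ s \<noteq> 0" "qpoch_inf ((of_real z *s x) $ s) q \<noteq> 0"
        "qpoch_inf (of_real q * (of_real (inverse z) *s y) $ s) q \<noteq> 0" for s
        using assms(3,5,7) assms(8)[of s] by (simp_all add: mult.assoc)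
      from L_term_eq[OF q this, of \<alpha> "of_real (z powr \<alpha>)" n] show ?thesis
        by (simp add: P_def prod.distrib mult_ac)
    qed
    finally show ?thesis .
  qed
  have swap: "(\<lambda>(n, p). f p n) summable_on UNIV \<times> UNIV" if "(\<lambda>(p, n). f p n) summable_on UNIV \<times> UNIV"
    for f :: "(nat ^ 'r) \<times> (nat ^ 'r) \<Rightarrow> int \<Rightarrow> complex"
    using that by (subst summable_on_swap) (simp add: case_prod_unfold)
  have L_summable: "?L summable_on UNIV"
  proof -
    have "(\<lambda>n. ?L n * P) summable_on UNIV"
      using summable_on_Sigma_banach[OF swap[OF T_summable]] by (simp add: L_term_sum)
    then show ?thesis
      using P by (simp add: summable_on_cmult_left')
  qed
  have rotate: "H_term \<alpha> (exp (2 * of_real pi * \<i> * of_int m / of_real \<alpha>) *s x)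
      (exp (- 2 * of_real pi * \<i> * of_int m / of_real \<alpha>) *s y) q (fst p) (snd p) =
      A p * cis (2 * pi * of_int m / \<alpha> * d p)" for m :: int and p
    using H_term_rotate[of \<alpha> "2 * of_real pi * \<i> * of_int m / of_real \<alpha>" x y q "fst p" "snd p"]
    by (simp add: A_def d_def case_prod_unfold cis_conv_exp mult_ac)
  have H_summable: "(\<lambda>(i, j). H_term \<alpha> (exp (2 * of_real pi * \<i> * of_int m / of_real \<alpha>) *s x)
      (exp (- 2 * of_real pi * \<i> * of_int m / of_real \<alpha>) *s y) q i j) summable_on UNIV" for m :: int
    unfolding case_prod_unfold rotate
    by (rule abs_summable_summable) (simp add: norm_mult A_summable)
  have U_sum: "(\<Sum>\<^sub>\<infinity>p. U p m) = of_real (K * sqrt (pi / a)) * R m" for m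
  proof -
    \<comment> \<open>For integer \<open>m\<close> both are the same sign; this turns the
      \<open>- 1 / 2\<close> in the centre into the \<open>1 / 2\<close> of the stated
      phase.\<close>
    have half: "cis (- (pi * of_int m)) = cis (pi * of_int m)"
      by (simp add: complex_eq_iff sin_int_times_real mult.commute)
    have "of_int m * b p * (2 * pi) = 2 * pi * of_int m / \<alpha> * d p + (- (pi * of_int m) + - (2 * pi * of_int m * ln z / t))" for p
      by (simp add: b_def algebra_simps)
    then have "cis (2 * pi * of_int m * b p) = cis (2 * pi * of_int m / \<alpha> * d p) *
        (cis (pi * of_int m) * cis (- (2 * pi * of_int m * ln z / t)))" for p
      by (simp only: half[symmetric] cis_mult mult_ac)
    then have "U p m = of_real (K * sqrt (pi / a)) * (A p * cis (2 * pi * of_int m / \<alpha> * d p) *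
        (of_real (E m) * (cis (pi * of_int m) * cis (- (2 * pi * of_int m * ln z / t)))))" for p
      by (simp add: U_def mult_ac)
    then have "(\<Sum>\<^sub>\<infinity>p. U p m) = of_real (K * sqrt (pi / a)) * ((\<Sum>\<^sub>\<infinity>p. A p * cis (2 * pi * of_int m / \<alpha> * d p)) *
        (of_real (E m) * (cis (pi * of_int m) * cis (- (2 * pi * of_int m * ln z / t)))))"
      by (simp only: infsum_cmult_right' infsum_cmult_left')
    moreover have "of_real (E m) * (cis (pi * of_int m) * cis (- (2 * pi * of_int m * ln z / t))) =
        exp (2 * of_real pi * \<i> * of_int m * (1 / 2 - 1 / of_real t * of_real (ln z))
                       - 2 * of_real pi ^ 2 * of_int m ^ 2 / (of_real \<alpha> * of_real t))"
      unfolding E_def cis_conv_exp exp_of_real[symmetric] exp_add[symmetric]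
      by (rule arg_cong[of _ _ exp]) (use \<alpha>0 assms(1) in \<open>simp add: a_def field_simps\<close>)
    ultimately show ?thesis
      unfolding R_def H_def case_prod_unfold rotate by simp
  qed
  have KC: "K * sqrt (pi / a) > 0"
    using K a by simp
  have R_summable: "R summable_on UNIV"
  proof -
    have "(\<lambda>m. of_real (K * sqrt (pi / a)) * R m) summable_on UNIV"
      using summable_on_Sigma_banach[OF swap[OF U_summable]] by (simp only: U_sum)
    then show ?thesis
      using KC by (subst (asm) summable_on_cmult_right') auto
  qed
  have "L \<alpha> (of_real z *s x) (of_real (inverse z) *s y) q (of_real (z powr \<alpha>)) * P = (\<Sum>\<^sub>\<infinity>n. \<Sum>\<^sub>\<infinity>p. T p n)"
    unfolding L_def L_term_sum infsum_cmult_left' ..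
  also have "\<dots> = (\<Sum>\<^sub>\<infinity>p. \<Sum>\<^sub>\<infinity>n. T p n)"
    by (rule infsum_swap_banach[OF T_summable, symmetric])
  also have "\<dots> = (\<Sum>\<^sub>\<infinity>m. \<Sum>\<^sub>\<infinity>p. U p m)"
    unfolding T_sum by (rule infsum_swap_banach[OF U_summable])
  also have "\<dots> = of_real (K * sqrt (pi / a)) * (\<Sum>\<^sub>\<infinity>m. R m)"
    unfolding U_sum infsum_cmult_right' ..
  \<comment> \<open>The summand \<open>\<alpha> / 2 * ln z\<close> in the exponent of
    \<open>K\<close> becomes the factor \<open>z powr \<alpha>\<close> under the square
    root.\<close>
  also have "K * sqrt (pi / a) = sqrt (2 * pi * z powr \<alpha> / (\<alpha> * t)) * exp (\<alpha> * t / 8 + \<alpha> / (2 * t) * (ln z)\<^sup>2)"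
  proof -
    have "sqrt (z powr \<alpha>) = exp (\<alpha> / 2 * ln z)"
      using assms(3) by (intro real_sqrt_unique) (simp_all add: powr_def flip: exp_double)
    moreover have "2 * pi * z powr \<alpha> / (\<alpha> * t) = pi / a * z powr \<alpha>"
      by (simp add: a_def)
    ultimately show ?thesis
      by (simp only: K_def real_sqrt_mult exp_add) simp
  qed
  finally have main: "L \<alpha> (of_real z *s x) (of_real (inverse z) *s y) q (of_real (z powr \<alpha>)) =
    of_real (sqrt (2 * pi * z powr \<alpha> / (\<alpha> * t)) * exp (\<alpha> * t / 8 + \<alpha> / (2 * t) * (ln z)\<^sup>2)) / P * (\<Sum>\<^sub>\<infinity>m. R m)"
    using P by (simp add: field_simps)
  show ?thesis
    using L_summable H_summable R_summable main unfolding R_def P_def by blast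
qed

end
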